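(* There exist $f\in\mathrm{Diff}_0^\infty(A)$ and a sequence of positive real numbers $\epsilon_n\to 0^+$ as $n\to\infty$ such that, for all $n\in\mathbb{N}$, $\mathrm{Fix}(\tilde f_{\epsilon_n})\neq\emptyset$, where $\tilde f\in\mathrm{Diff}_0^\infty(\tilde A)$ is the lift of $f$ which fixes every point of $\mathbb{R}\times\{0\}$ and $\tilde f_{\epsilon}:\tilde A\to\tilde A$ is defined by $\tilde f_{\epsilon}(x,y)=\tilde f(x,y)+(\epsilon,0)$ for $\epsilon\in\mathbb{R}$.
   Context: Let $A=S^1\times[0,1]$ with $S^1=\mathbb{R}/\mathbb{Z}$, let $\tilde A=\mathbb{R}\times[0,1]$, and let $p:\tilde A\to A$, $p(x,y)=(x \bmod 1,y)$, be the covering map. Let $p_1:\tilde A\to\mathbb{R}$ denote the projection onto the first factor. $\mathrm{Fix}(\cdot)$ denotes the set of fixed points of a map. For $k\in\mathbb{N}\cup\{\infty,\omega\}$ ($C^\omega$ meaning real-analytic), $\mathrm{Diff}^k(A)$ is the set of $C^k$-diffeomorphisms $f:A\to A$ which preserve area (i.e. preserve the area form $dx\wedge dy$) and are homotopic to the identity map. $\mathrm{Diff}_0^k(A)\subset \mathrm{Diff}^k(A)$ is the subset of those $f$ such that: (1) $f(x,0)=(x,0)$ for all $x\in S^1$; (2) if $\tilde f:\tilde A\to\tilde A$ is the lift of $f$ with $\tilde f(x,0)=(x,0)$ for all $x\in\mathbb{R}$, then $\mathrm{Fix}(\tilde f)=\mathbb{R}\times\{0\}$; (3) for this lift, $p_1\circ\tilde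 f(x,1)>x$ for all $x\in\mathbb{R}$. $\mathrm{Diff}_0^k(\tilde A)$ is the set of lifts to $\tilde A$ of maps in $\mathrm{Diff}_0^k(A)$ which fix all points of $\mathbb{R}\times\{0\}$. *)

theory Defs
  imports "HOL-Analysis.Analysis" "HOL-Library.Extended_Nat"
begin

text \<open>The circle as the quotient group of the reals by the integers, with the quotient topology.\<close>

quotient_type circle = real / "\<lambda>x y. x - y \<in> \<int>"
  morphisms circle_rep circle_of
proof (rule equivpI)
  show "reflp (\<lambda>x y :: real. x - y \<in> \<int>)"
    by (simp add: reflp_def)
  show "symp (\<lambda>x y :: real. x - y \<in> \<int>)"
    by (metis Ints_minus minus_diff_eq sympI)
  show "transp (\<lambda>x y :: real. x - y \<in> \<int>)"
  proof (rule transpI)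
    fix x y z :: real
    assume "x - y \<in> \<int>" "y - z \<in> \<int>"
    then have "(x - y) + (y - z) \<in> \<int>" by (rule Ints_add)
    then show "x - z \<in> \<int>" by simp
  qed
qed

instantiation circle :: topological_space
begin

definition open_circle :: "circle set \<Rightarrow> bool" where
  "open_circle U \<longleftrightarrow> open (circle_of -` U)"

instance
proof
  show "open (UNIV :: circle set)"
    by (simp add: open_circle_def)
  show "open (S \<inter> T)" if "open S" "open T" for S T :: "circle set"
    using that by (simp add: open_circle_def open_Int)
  show "open (\<Union> K)" if "\<forall>S\<in>K. open S" for K :: "circle set set"
    using that by (auto simp: open_circle_def vimage_Union)
qed

end

definition annulus :: "(circle \<times> real) set" where
  "annulus = UNIV \<times> {0..1}"

definition strip :: "(real \<times> real) set" where
  "strip = UNIV \<times> {0..1}"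

definition cover :: "real \<times> real \<Rightarrow> circle \<times> real" where
  "cover z = (circle_of (fst z), snd z)"

text \<open>
  Derivatives are taken within \<open>S\<close>, so they are one-sided at boundary points of \<open>S\<close>. On the
  sets used below (relatively open subsets of the strip) they are unique, and \<open>Cn_on\<close> is
  smoothness up to the boundary.
\<close>

primrec Cn_on ::
    "nat \<Rightarrow> 'a::real_normed_vector set \<Rightarrow> ('a \<Rightarrow> 'b::real_normed_vector) \<Rightarrow> bool" where
  "Cn_on 0 S F \<longleftrightarrow> continuous_on S F"
| "Cn_on (Suc n) S F \<longleftrightarrow>
     (\<exists>D. (\<forall>z\<in>S. (F has_derivative D z) (at z within S)) \<and> (\<forall>v. Cn_on n S (\<lambda>z. D z v)))"

definition Ck_on ::
    "enat \<Rightarrow> 'a::real_normed_vector set \<Rightarrow> ('a \<Rightarrow> 'b::real_normed_vector) \<Rightarrow> bool" where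
  "Ck_on k S F \<longleftrightarrow> (\<forall>n. enat n \<le> k \<longrightarrow> Cn_on n S F)"

text \<open>
  The charts of the annulus are the local inverses of \<open>cover\<close>, so the coordinate expressions
  of a map \<open>f\<close> of the annulus are its local lifts. Only the values of \<open>f\<close> on \<open>annulus\<close> and of
  a lift on \<open>strip\<close> matter.
\<close>

definition local_lift ::
    "(circle \<times> real \<Rightarrow> circle \<times> real) \<Rightarrow> (real \<times> real) set \<Rightarrow> (real \<times> real \<Rightarrow> real \<times> real) \<Rightarrow> bool"
  where
  "local_lift f U F \<longleftrightarrow>
     open U \<and> continuous_on (strip \<inter> U) F \<and> F ` (strip \<inter> U) \<subseteq> strip \<and>
     (\<forall>z \<in> strip \<inter> U. cover (F z) = f (cover z))"

definition is_lift ::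
    "(circle \<times> real \<Rightarrow> circle \<times> real) \<Rightarrow> (real \<times> real \<Rightarrow> real \<times> real) \<Rightarrow> bool" where
  "is_lift f F \<longleftrightarrow> local_lift f UNIV F"

definition annulus_Ck :: "enat \<Rightarrow> (circle \<times> real \<Rightarrow> circle \<times> real) \<Rightarrow> bool" where
  "annulus_Ck k f \<longleftrightarrow>
     (\<forall>z\<in>strip. \<exists>U F. z \<in> U \<and> local_lift f U F \<and> Ck_on k (strip \<inter> U) F)"

definition area_form :: "real \<times> real \<Rightarrow> real \<times> real \<Rightarrow> real" where
  "area_form u v = fst u * snd v - snd u * fst v"

text \<open>
  The pullback of the area form by \<open>f\<close> is the area form. Two local lifts near \<open>z\<close> differ by an
  integer translation, so the condition does not depend on the choice of \<open>F\<close>.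
\<close>

definition preserves_area :: "(circle \<times> real \<Rightarrow> circle \<times> real) \<Rightarrow> bool" where
  "preserves_area f \<longleftrightarrow>
     (\<forall>z\<in>strip. \<exists>U F D. z \<in> U \<and> local_lift f U F \<and>
        (F has_derivative D) (at z within (strip \<inter> U)) \<and>
        (\<forall>u v. area_form (D u) (D v) = area_form u v))"

text \<open>Meant for \<open>k \<ge> 1\<close>; \<open>k = \<infinity>\<close> gives the smooth diffeomorphisms.\<close>

definition Diff :: "enat \<Rightarrow> (circle \<times> real \<Rightarrow> circle \<times> real) set" where
  "Diff k = {f. bij_betw f annulus annulus \<and>
                annulus_Ck k f \<and> annulus_Ck k (inv_into annulus f) \<and>
                preserves_area f \<and>
                homotopic_with_canon (\<lambda>_. True) annulus annulus f id}"

definition Fix :: "(real \<times> real \<Rightarrow> real \<times> real) \<Rightarrow> (real \<times> real) set" where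
  "Fix F = {z \<in> strip. F z = z}"

text \<open>
  The lift \<open>F\<close> below exists by the pointwise fixing of the lower boundary, and is unique on
  \<open>strip\<close>, so the existential quantifier stands for ``the lift''.
\<close>

definition Diff0 :: "enat \<Rightarrow> (circle \<times> real \<Rightarrow> circle \<times> real) set" where
  "Diff0 k = {f \<in> Diff k.
     (\<forall>x. f (x, 0) = (x, 0)) \<and>
     (\<exists>F. is_lift f F \<and> (\<forall>x. F (x, 0) = (x, 0)) \<and>
          Fix F = UNIV \<times> {0} \<and>
          (\<forall>x. fst (F (x, 1)) > x))}"

definition Diff0_lifts :: "enat \<Rightarrow> (real \<times> real \<Rightarrow> real \<times> real) set" where
  "Diff0_lifts k = {F. \<exists>f \<in> Diff0 k. is_lift f F \<and> (\<forall>x. F (x, 0) = (x, 0))}"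

definition shifted :: "(real \<times> real \<Rightarrow> real \<times> real) \<Rightarrow> real \<Rightarrow> real \<times> real \<Rightarrow> real \<times> real" where
  "shifted F \<epsilon> z = F z + (\<epsilon>, 0)"

end

theory Submission
  imports Defs
begin

text \<open>
  On the open half plane \<open>y > 0\<close> the map is a conjugate \<open>F = G\<^sup>-\<^sup>1 \<circ> T \<circ> G\<close> of the shear
  \<open>T (x, y) = (x + \<phi> y, y)\<close> with \<open>\<phi> > 0\<close>, so it has no fixed points there. The conjugating map
  \<open>G = P \<circ> S \<circ> P\<^sup>-\<^sup>1\<close> is built from \<open>P (x, y) = (g x, y / g' x)\<close>, where \<open>g\<close> lifts a circle
  diffeomorphism, and the shear \<open>S (x, y) = (x + \<psi> y, y)\<close>, where \<open>\<psi> y = 7 ln y\<close> near \<open>y = 0\<close> and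
  \<open>\<psi> y = 0\<close> for \<open>y \<ge> 1/2\<close>; hence \<open>G\<close> is the identity for \<open>y \<ge> 1\<close>.

  The derivatives of \<open>G\<close> and \<open>G\<^sup>-\<^sup>1\<close> grow at most like powers of \<open>y + 1/y\<close>, while
  \<open>\<phi> y = exp (-(y + 1/y))\<close> decays faster than any such power, together with its derivatives.
  So \<open>F\<close> differs from the identity by a function that vanishes to infinite order at \<open>y = 0\<close>.

  The steep logarithmic shear makes the invariant curve \<open>G\<^sup>-\<^sup>1 {y = H}\<close> fold back, with a
  local maximum of its height on a backward branch. Close to this maximum, \<open>F\<close> moves some
  point of the curve to the point of the same height on the other side, that is, horizontally
  to the left.
  For \<open>H = exp (-n/7)\<close> these curves agree up to rescaling \<open>y\<close> and a translation by \<open>n\<close>,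
  while \<open>\<phi> H\<close> tends to \<open>0\<close>.
\<close>

section \<open>Tempered and rapidly decreasing functions on the half plane\<close>

text \<open>
  The weight also grows as \<open>y \<rightarrow> \<infinity>\<close>, so that no upper bound on the heights has to be tracked
  in compositions.
\<close>

definition weight :: "real \<Rightarrow> real" where "weight y = y + 1 / y"

definition tempered :: "(real \<times> real \<Rightarrow> real) \<Rightarrow> bool" where
  "tempered f \<longleftrightarrow> (\<exists>N::nat. \<exists>C. \<forall>z. snd z > 0 \<longrightarrow> \<bar>f z\<bar> \<le> C * weight (snd z) ^ N)"

definition rapid :: "(real \<times> real \<Rightarrow> real) \<Rightarrow> bool" where
  "rapid f \<longleftrightarrow> (\<forall>N::nat. \<exists>C. \<forall>z. snd z > 0 \<longrightarrow> \<bar>f z\<bar> * weight (snd z) ^ N \<le> C)"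

definition has_partials ::
    "(real \<times> real \<Rightarrow> real) \<Rightarrow> (real \<times> real \<Rightarrow> real) \<Rightarrow> (real \<times> real \<Rightarrow> real) \<Rightarrow> bool" where
  "has_partials f p q \<longleftrightarrow>
     (\<forall>z. snd z > 0 \<longrightarrow> (f has_derivative (\<lambda>v. p z * fst v + q z * snd v)) (at z))"

text \<open>The growth condition \<open>B\<close> is a parameter, so that one calculus serves both
  \<open>tempered\<close> and \<open>rapid\<close> functions. Partial derivatives are asserted to
  exist instead of being computed by an operator.\<close>

primrec jet :: "((real \<times> real \<Rightarrow> real) \<Rightarrow> bool) \<Rightarrow> nat \<Rightarrow> (real \<times> real \<Rightarrow> real) \<Rightarrow> bool" where
  "jet B 0 f \<longleftrightarrow> B f"
| "jet B (Suc n) f \<longleftrightarrow> B f \<and> (\<exists>p q. has_partials f p q \<and> jet B n p \<and> jet B n q)"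

text \<open>The function itself is left unbounded: a coordinate such as \<open>fst\<close> is not
  tempered, because the bound has to be uniform in \<open>x\<close>, but its derivatives
  are.\<close>

definition djet :: "nat \<Rightarrow> (real \<times> real \<Rightarrow> real) \<Rightarrow> bool" where
  "djet n f \<longleftrightarrow> (\<exists>p q. has_partials f p q \<and> jet tempered n p \<and> jet tempered n q)"

text \<open>Inner maps with such a height component change the weight by a factor of at most 3 and
  so preserve both growth classes. The 3 is the ratio of the bounds 3/2 and 1/2 of
  \<open>speed\<close>.\<close>

definition comparable :: "(real \<times> real \<Rightarrow> real) \<Rightarrow> bool" where
  "comparable b \<longleftrightarrow> (\<forall>z. snd z > 0 \<longrightarrow> snd z / 3 \<le> b z \<and> b z \<le> 3 * snd z)"

lemma weight_ge_1: "y > 0 \<Longrightarrow> weight y \<ge> 1"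
proof (cases "y \<ge> 1")
  case False
  assume "y > 0"
  then show ?thesis using False by (simp add: weight_def add_increasing)
next
  case True
  then show ?thesis by (simp add: weight_def add_increasing2)
qed

lemma comparable_pos: "comparable b \<Longrightarrow> snd z > 0 \<Longrightarrow> b z > 0"
  unfolding comparable_def by (smt (verit) divide_pos_pos)

lemma weight_scale:
  assumes "y > 0" "y / 3 \<le> c" "c \<le> 3 * y"
  shows "weight c \<le> 3 * weight y"
proof -
  have "c > 0" using assms by linarith
  then have "1 / c \<le> 3 / y" using assms by (simp add: field_simps)
  then show ?thesis unfolding weight_def using assms by simp
qed

lemma weight_comparable:
  assumes "comparable b" "snd z > 0"
  shows "weight (b z) \<le> 3 * weight (snd z)" "weight (snd z) \<le> 3 * weight (b z)"
proof -
  have *: "snd z / 3 \<le> b z" "b z \<le> 3 * snd z" "b z > 0"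
    using assms comparable_pos[OF assms] unfolding comparable_def by blast+
  show "weight (b z) \<le> 3 * weight (snd z)" using weight_scale assms * by blast
  show "weight (snd z) \<le> 3 * weight (b z)" using * by (intro weight_scale) auto
qed

lemma tempered_add: "tempered f \<Longrightarrow> tempered g \<Longrightarrow> tempered (\<lambda>z. f z + g z)"
proof -
  assume "tempered f" "tempered g"
  then obtain M N C D where
    f: "\<And>z. snd z > 0 \<Longrightarrow> \<bar>f z\<bar> \<le> C * weight (snd z) ^ M" and
    g: "\<And>z. snd z > 0 \<Longrightarrow> \<bar>g z\<bar> \<le> D * weight (snd z) ^ N"
    unfolding tempered_def by metis
  have "\<bar>f z + g z\<bar> \<le> (\<bar>C\<bar> + \<bar>D\<bar>) * weight (snd z) ^ (M + N)" if "snd z > 0" for z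
  proof -
    have 1: "weight (snd z) ^ M \<le> weight (snd z) ^ (M + N)"
      "weight (snd z) ^ N \<le> weight (snd z) ^ (M + N)"
      using weight_ge_1[OF that] by (auto intro: power_increasing)
    have "C * weight (snd z) ^ M \<le> \<bar>C\<bar> * weight (snd z) ^ (M + N)"
      "D * weight (snd z) ^ N \<le> \<bar>D\<bar> * weight (snd z) ^ (M + N)"
      using 1 weight_ge_1[OF that] by (auto intro!: mult_mono)
    then show ?thesis using f[OF that] g[OF that] by (simp add: distrib_right)
  qed
  then show ?thesis unfolding tempered_def by blast
qed

lemma rapid_add: "rapid f \<Longrightarrow> rapid g \<Longrightarrow> rapid (\<lambda>z. f z + g z)"
  unfolding rapid_def
proof
  fix N
  assume a: "\<forall>N. \<exists>C. \<forall>z. 0 < snd z \<longrightarrow> \<bar>f z\<bar> * weight (snd z) ^ N \<le> C"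
    "\<forall>N. \<exists>C. \<forall>z. 0 < snd z \<longrightarrow> \<bar>g z\<bar> * weight (snd z) ^ N \<le> C"
  then obtain C D where
    f: "\<And>z. snd z > 0 \<Longrightarrow> \<bar>f z\<bar> * weight (snd z) ^ N \<le> C" and
    g: "\<And>z. snd z > 0 \<Longrightarrow> \<bar>g z\<bar> * weight (snd z) ^ N \<le> D"
    by metis
  have "\<bar>f z + g z\<bar> * weight (snd z) ^ N \<le> C + D" if "snd z > 0" for z
  proof -
    have "\<bar>f z + g z\<bar> * weight (snd z) ^ N \<le> (\<bar>f z\<bar> + \<bar>g z\<bar>) * weight (snd z) ^ N"
      using weight_ge_1[OF that] by (intro mult_right_mono) auto
    then show ?thesis using f[OF that] g[OF that] by (simp add: distrib_right)
  qed
  then show "\<exists>C. \<forall>z. 0 < snd z \<longrightarrow> \<bar>f z + g z\<bar> * weight (snd z) ^ N \<le> C" by blast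
qed

lemma tempered_mult: "tempered f \<Longrightarrow> tempered g \<Longrightarrow> tempered (\<lambda>z. f z * g z)"
proof -
  assume "tempered f" "tempered g"
  then obtain M N C D where
    f: "\<And>z. snd z > 0 \<Longrightarrow> \<bar>f z\<bar> \<le> C * weight (snd z) ^ M" and
    g: "\<And>z. snd z > 0 \<Longrightarrow> \<bar>g z\<bar> \<le> D * weight (snd z) ^ N"
    unfolding tempered_def by metis
  have "\<bar>f z * g z\<bar> \<le> (C * D) * weight (snd z) ^ (M + N)" if "snd z > 0" for z
    using mult_mono'[OF f[OF that] g[OF that]] by (simp add: abs_mult power_add mult_ac)
  then show ?thesis unfolding tempered_def by blast
qed

lemma rapid_mult: "rapid f \<Longrightarrow> tempered g \<Longrightarrow> rapid (\<lambda>z. f z * g z)"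
proof -
  assume r: "rapid f" and "tempered g"
  then obtain M D where g: "\<And>z. snd z > 0 \<Longrightarrow> \<bar>g z\<bar> \<le> D * weight (snd z) ^ M"
    unfolding tempered_def by metis
  show ?thesis
    unfolding rapid_def
  proof
    fix N
    obtain C where f: "\<And>z. snd z > 0 \<Longrightarrow> \<bar>f z\<bar> * weight (snd z) ^ (M + N) \<le> C"
      using r unfolding rapid_def by metis
    have "\<bar>f z * g z\<bar> * weight (snd z) ^ N \<le> \<bar>D\<bar> * C" if "snd z > 0" for z
    proof -
      have w: "weight (snd z) \<ge> 1" by (rule weight_ge_1[OF that])
      have "\<bar>g z\<bar> \<le> \<bar>D\<bar> * weight (snd z) ^ M"
        using g[OF that] w by (smt (verit) mult_right_mono zero_le_power)
      then have "\<bar>f z\<bar> * \<bar>g z\<bar> * weight (snd z) ^ N \<le>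
        \<bar>f z\<bar> * (\<bar>D\<bar> * weight (snd z) ^ M) * weight (snd z) ^ N"
        using w by (intro mult_right_mono mult_left_mono) auto
      also have "\<dots> = \<bar>D\<bar> * (\<bar>f z\<bar> * weight (snd z) ^ (M + N))" by (simp add: power_add)
      also have "\<dots> \<le> \<bar>D\<bar> * C" using f[OF that] by (intro mult_left_mono) auto
      finally show ?thesis by (simp add: abs_mult)
    qed
    then show "\<exists>C. \<forall>z. 0 < snd z \<longrightarrow> \<bar>f z * g z\<bar> * weight (snd z) ^ N \<le> C" by blast
  qed
qed

lemma rapid_imp_tempered: "rapid f \<Longrightarrow> tempered f"
proof -
  assume "rapid f"
  then obtain C where "\<And>z. snd z > 0 \<Longrightarrow> \<bar>f z\<bar> * weight (snd z) ^ 0 \<le> C"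
    unfolding rapid_def by metis
  then have "\<forall>z. snd z > 0 \<longrightarrow> \<bar>f z\<bar> \<le> C * weight (snd z) ^ 0" by simp
  then show ?thesis unfolding tempered_def by blast
qed

lemma rapid_mono:
  assumes "rapid g" "\<And>z. snd z > 0 \<Longrightarrow> \<bar>f z\<bar> \<le> \<bar>g z\<bar>"
  shows "rapid f"
  unfolding rapid_def
proof
  fix N
  obtain C where C: "\<And>z. snd z > 0 \<Longrightarrow> \<bar>g z\<bar> * weight (snd z) ^ N \<le> C"
    using assms unfolding rapid_def by metis
  have "\<bar>f z\<bar> * weight (snd z) ^ N \<le> C" if "snd z > 0" for z
  proof -
    have "\<bar>f z\<bar> * weight (snd z) ^ N \<le> \<bar>g z\<bar> * weight (snd z) ^ N"
      using assms(2)[OF that] weight_ge_1[OF that] by (intro mult_right_mono) auto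
    then show ?thesis using C[OF that] by linarith
  qed
  then show "\<exists>C. \<forall>z. 0 < snd z \<longrightarrow> \<bar>f z\<bar> * weight (snd z) ^ N \<le> C" by blast
qed

lemma tempered_compose:
  assumes "tempered f" "comparable b"
  shows "tempered (\<lambda>z. f (a z, b z))"
proof -
  obtain N C where f: "\<And>z. snd z > 0 \<Longrightarrow> \<bar>f z\<bar> \<le> C * weight (snd z) ^ N"
    using assms unfolding tempered_def by metis
  have "\<bar>f (a z, b z)\<bar> \<le> (\<bar>C\<bar> * 3 ^ N) * weight (snd z) ^ N" if z: "snd z > 0" for z
  proof -
    have b: "b z > 0" using assms z comparable_pos by blast
    have "\<bar>f (a z, b z)\<bar> \<le> C * weight (b z) ^ N" using f[of "(a z, b z)"] b by simp
    also have "\<dots> \<le> \<bar>C\<bar> * (3 * weight (snd z)) ^ N"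
      using weight_comparable[OF assms(2) z] weight_ge_1[OF b] by (intro mult_mono power_mono) auto
    finally show ?thesis by (simp add: power_mult_distrib)
  qed
  then show ?thesis unfolding tempered_def by blast
qed

lemma rapid_compose:
  assumes "rapid f" "comparable b"
  shows "rapid (\<lambda>z. f (a z, b z))"
  unfolding rapid_def
proof
  fix N
  obtain C where f: "\<And>z. snd z > 0 \<Longrightarrow> \<bar>f z\<bar> * weight (snd z) ^ N \<le> C"
    using assms unfolding rapid_def by metis
  have "\<bar>f (a z, b z)\<bar> * weight (snd z) ^ N \<le> 3 ^ N * C" if z: "snd z > 0" for z
  proof -
    have b: "b z > 0" using assms z comparable_pos by blast
    have "\<bar>f (a z, b z)\<bar> * weight (snd z) ^ N \<le> \<bar>f (a z, b z)\<bar> * (3 * weight (b z)) ^ N"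
      using weight_comparable[OF assms(2) z] weight_ge_1[OF z]
        by (intro mult_left_mono power_mono) auto
    also have "\<dots> = 3 ^ N * (\<bar>f (a z, b z)\<bar> * weight (b z) ^ N)" by (simp add: power_mult_distrib)
    also have "\<dots> \<le> 3 ^ N * C" using f[of "(a z, b z)"] b by simp
    finally show ?thesis .
  qed
  then show "\<exists>C. \<forall>z. 0 < snd z \<longrightarrow> \<bar>f (a z, b z)\<bar> * weight (snd z) ^ N \<le> C" by blast
qed

section \<open>Calculus of partial derivatives on the open half plane\<close>

lemma has_partialsD:
  "has_partials f p q \<Longrightarrow> snd z > 0 \<Longrightarrow>
   (f has_derivative (\<lambda>v. p z * fst v + q z * snd v)) (at z)"
  unfolding has_partials_def by blast

lemma has_partials_add:
  "has_partials f p q \<Longrightarrow> has_partials g r s \<Longrightarrow>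
   has_partials (\<lambda>z. f z + g z) (\<lambda>z. p z + r z) (\<lambda>z. q z + s z)"
  unfolding has_partials_def by (auto intro!: derivative_eq_intros simp: algebra_simps)

lemma has_partials_mult:
  "has_partials f p q \<Longrightarrow> has_partials g r s \<Longrightarrow>
   has_partials (\<lambda>z. f z * g z) (\<lambda>z. p z * g z + f z * r z) (\<lambda>z. q z * g z + f z * s z)"
  unfolding has_partials_def by (auto intro!: derivative_eq_intros simp: algebra_simps)

lemma has_partials_const: "has_partials (\<lambda>_. c) (\<lambda>_. 0) (\<lambda>_. 0)"
  unfolding has_partials_def by auto

lemma has_partials_fst: "has_partials fst (\<lambda>_. 1) (\<lambda>_. 0)"
  unfolding has_partials_def by (auto intro!: derivative_eq_intros)

lemma has_partials_snd: "has_partials snd (\<lambda>_. 0) (\<lambda>_. 1)"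
  unfolding has_partials_def by (auto intro!: derivative_eq_intros)

lemma has_partials_real:
  assumes "\<And>z. snd z > 0 \<Longrightarrow> (h has_real_derivative h' (a z)) (at (a z))" "has_partials a p q"
  shows "has_partials (\<lambda>z. h (a z)) (\<lambda>z. h' (a z) * p z) (\<lambda>z. h' (a z) * q z)"
  unfolding has_partials_def
proof (intro allI impI)
  fix z :: "real \<times> real" assume z: "snd z > 0"
  have "((\<lambda>z. h (a z)) has_derivative (\<lambda>v. h' (a z) * (p z * fst v + q z * snd v))) (at z)"
    using has_derivative_compose[of a "\<lambda>v. p z * fst v + q z * snd v" z UNIV h "(*) (h' (a z))"]
      assms z unfolding has_partials_def has_field_derivative_def by auto
  then show "((\<lambda>z. h (a z)) has_derivative (\<lambda>v. h' (a z) * p z * fst v +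
    h' (a z) * q z * snd v)) (at z)"
    by (simp add: algebra_simps)
qed

lemma has_partials_compose:
  assumes "has_partials f p q" "has_partials a a1 a2" "has_partials b b1 b2"
    "\<And>z. snd z > 0 \<Longrightarrow> b z > 0"
  shows "has_partials (\<lambda>z. f (a z, b z)) (\<lambda>z. p (a z, b z) * a1 z + q (a z, b z) * b1 z)
    (\<lambda>z. p (a z, b z) * a2 z + q (a z, b z) * b2 z)"
  unfolding has_partials_def
proof (intro allI impI)
  fix z :: "real \<times> real" assume z: "snd z > 0"
  have ab: "((\<lambda>z. (a z, b z)) has_derivative
      (\<lambda>v. (a1 z * fst v + a2 z * snd v, b1 z * fst v + b2 z * snd v))) (at z)"
    using has_partialsD[OF assms(2) z] has_partialsD[OF assms(3) z] by (rule has_derivative_Pair)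
  have "(f has_derivative (\<lambda>v. p (a z, b z) * fst v + q (a z, b z) * snd v)) (at (a z, b z))"
    using has_partialsD[OF assms(1)] assms(4)[OF z] by simp
  from has_derivative_compose[OF ab this]
  show "((\<lambda>z. f (a z, b z)) has_derivative
     (\<lambda>v. (p (a z, b z) * a1 z + q (a z, b z) * b1 z) * fst v +
           (p (a z, b z) * a2 z + q (a z, b z) * b2 z) * snd v)) (at z)"
    by (simp add: algebra_simps)
qed

lemma has_partials_cong:
  assumes "has_partials f p q" "\<And>z. snd z > 0 \<Longrightarrow> f z = g z"
  shows "has_partials g p q"
  unfolding has_partials_def
proof (intro allI impI)
  fix z :: "real \<times> real" assume z: "snd z > 0"
  have "open {z :: real \<times> real. snd z > 0}" by (intro open_Collect_less continuous_intros)
  then show "(g has_derivative (\<lambda>v. p z * fst v + q z * snd v)) (at z)"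
    by (rule has_derivative_transform_within_open[OF has_partialsD[OF assms(1) z]])
      (use assms(2) z in auto)
qed

section \<open>Closure properties of jets with growth conditions\<close>

lemma jet_base: "jet B n f \<Longrightarrow> B f"
  by (cases n) auto

lemma jet_SucI: "B f \<Longrightarrow> has_partials f p q \<Longrightarrow> jet B n p \<Longrightarrow> jet B n q \<Longrightarrow> jet B (Suc n) f"
  by auto

lemma jet_SucE:
  assumes "jet B (Suc n) f"
  obtains p q where "B f" "has_partials f p q" "jet B n p" "jet B n q"
  using assms by auto

lemma djetE:
  assumes "djet n f"
  obtains p q where "has_partials f p q" "jet tempered n p" "jet tempered n q"
  using assms unfolding djet_def by blast

lemma jet_SucD: "jet B (Suc n) f \<Longrightarrow> jet B n f"
proof (induction n arbitrary: f)
  case (Suc n)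
  obtain p q where "B f" "has_partials f p q" "jet B (Suc n) p" "jet B (Suc n) q"
    using Suc.prems by (rule jet_SucE)
  then show ?case using Suc.IH by (intro jet_SucI)
qed simp

lemma jet_rapid_imp_tempered: "jet rapid n f \<Longrightarrow> jet tempered n f"
proof (induction n arbitrary: f)
  case (Suc n)
  obtain p q where "rapid f" "has_partials f p q" "jet rapid n p" "jet rapid n q"
    using Suc.prems by (rule jet_SucE)
  then show ?case using Suc.IH rapid_imp_tempered by (intro jet_SucI)
qed (simp add: rapid_imp_tempered)

lemma jet_tempered_imp_djet: "jet tempered (Suc n) f \<Longrightarrow> djet n f"
  unfolding djet_def by auto

text \<open>Partial derivatives and both growth conditions only see the open half plane; the
  restriction on \<open>B\<close> provides this.\<close>

lemma jet_cong:
  assumes "jet B n f" "\<And>z. snd z > 0 \<Longrightarrow> f z = g z" "B \<in> {tempered, rapid}"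
  shows "jet B n g"
proof -
  have "B g" using jet_base[OF assms(1)] assms(2,3) by (auto simp: tempered_def rapid_def)
  show ?thesis
  proof (cases n)
    case 0
    then show ?thesis using \<open>B g\<close> by simp
  next
    case (Suc m)
    obtain p q where "has_partials f p q" "jet B m p" "jet B m q"
      using assms(1) unfolding Suc by (rule jet_SucE)
    then show ?thesis
      unfolding Suc using \<open>B g\<close> assms(2) by (intro jet_SucI[OF _ has_partials_cong])
  qed
qed

lemma tempered_const: "tempered (\<lambda>_. c)"
  unfolding tempered_def by (rule exI[of _ 0]) auto

lemma jet_const: "jet tempered n (\<lambda>_. c)"
  by (induction n arbitrary: c) (use has_partials_const tempered_const in auto)

lemma jet_add:
  assumes "B \<in> {tempered, rapid}"
  shows "jet B n f \<Longrightarrow> jet B n g \<Longrightarrow> jet B n (\<lambda>z. f z + g z)"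
proof (induction n arbitrary: f g)
  case 0
  then show ?case using assms tempered_add rapid_add by auto
next
  case (Suc n)
  obtain p q where f: "B f" "has_partials f p q" "jet B n p" "jet B n q"
    using Suc.prems(1) by (rule jet_SucE)
  obtain r s where g: "B g" "has_partials g r s" "jet B n r" "jet B n s"
    using Suc.prems(2) by (rule jet_SucE)
  have "B (\<lambda>z. f z + g z)" using f g assms tempered_add rapid_add by auto
  then show ?case using Suc.IH f g by (intro jet_SucI[OF _ has_partials_add])
qed

text \<open>Rapid functions form an ideal over the tempered ones. The product rule also contains
  undifferentiated factors, which are covered by lowering the order of their jets.\<close>

lemma jet_mult:
  assumes "B \<in> {tempered, rapid}"
  shows "jet B n f \<Longrightarrow> jet tempered n g \<Longrightarrow> jet B n (\<lambda>z. f z * g z)"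
proof (induction n arbitrary: f g)
  case 0
  then show ?case using assms tempered_mult rapid_mult by auto
next
  case (Suc n)
  obtain p q where f: "B f" "has_partials f p q" "jet B n p" "jet B n q"
    using Suc.prems(1) by (rule jet_SucE)
  obtain r s where g: "tempered g" "has_partials g r s" "jet tempered n r" "jet tempered n s"
    using Suc.prems(2) by (rule jet_SucE)
  have "B (\<lambda>z. f z * g z)" using f g assms tempered_mult rapid_mult by auto
  moreover have "jet B n (\<lambda>z. p z * g z + f z * r z)" "jet B n (\<lambda>z. q z * g z + f z * s z)"
    by (intro jet_add[OF assms] Suc.IH f g jet_SucD[OF Suc.prems(1)] jet_SucD[OF Suc.prems(2)])+
  ultimately show ?case by (intro jet_SucI[OF _ has_partials_mult[OF f(2) g(2)]])
qed

lemma djet_SucD: "djet (Suc n) f \<Longrightarrow> djet n f"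
  unfolding djet_def using jet_SucD by blast

lemma djet_add: "djet n f \<Longrightarrow> djet n g \<Longrightarrow> djet n (\<lambda>z. f z + g z)"
  unfolding djet_def using has_partials_add jet_add[of tempered n] by blast

lemma djet_fst: "djet n fst" and djet_snd: "djet n snd"
  unfolding djet_def using has_partials_fst has_partials_snd jet_const by blast+

text \<open>One application of the chain rule. Composition at order \<open>n\<close> is a
  hypothesis, so that the step can be used inside the induction of \<open>jet_compose\<close> and
  once more after it.\<close>

lemma jet_compose_step:
  assumes "B \<in> {tempered, rapid}" "comparable b"
    and "jet B (Suc n) f" "djet n a" "djet n b"
    and comp: "\<And>g. jet B n g \<Longrightarrow> jet B n (\<lambda>z. g (a z, b z))"
  shows "jet B (Suc n) (\<lambda>z. f (a z, b z))"
proof -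
  obtain p q where f: "B f" "has_partials f p q" "jet B n p" "jet B n q"
    using assms(3) by (rule jet_SucE)
  obtain a1 a2 where a: "has_partials a a1 a2" "jet tempered n a1" "jet tempered n a2"
    using assms(4) by (rule djetE)
  obtain b1 b2 where b: "has_partials b b1 b2" "jet tempered n b1" "jet tempered n b2"
    using assms(5) by (rule djetE)
  have "B (\<lambda>z. f (a z, b z))" using f(1) assms(1,2) tempered_compose rapid_compose by auto
  moreover have "jet B n (\<lambda>z. p (a z, b z) * a1 z + q (a z, b z) * b1 z)"
    "jet B n (\<lambda>z. p (a z, b z) * a2 z + q (a z, b z) * b2 z)"
    by (intro jet_add[OF assms(1)] jet_mult[OF assms(1)] comp f a b)+
  ultimately show ?thesis
    by (intro jet_SucI[OF _ has_partials_compose[OF f(2) a(1) b(1) comparable_pos[OF assms(2)]]])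
qed

lemma jet_compose:
  assumes "B \<in> {tempered, rapid}" "comparable b"
  shows "jet B n f \<Longrightarrow> djet n a \<Longrightarrow> djet n b \<Longrightarrow> jet B n (\<lambda>z. f (a z, b z))"
proof (induction n arbitrary: f)
  case 0
  then show ?case using assms tempered_compose rapid_compose by auto
next
  case (Suc n)
  note d = djet_SucD[OF Suc.prems(2)] djet_SucD[OF Suc.prems(3)]
  show ?case by (rule jet_compose_step[OF assms Suc.prems(1) d Suc.IH[OF _ d]])
qed

text \<open>Only the derivatives of the inner map enter, so it may be one order less regular.\<close>

lemma jet_Suc_compose:
  assumes "B \<in> {tempered, rapid}" "comparable b"
    and "jet B (Suc n) f" "djet n a" "djet n b"
  shows "jet B (Suc n) (\<lambda>z. f (a z, b z))"
  by (rule jet_compose_step[OF assms jet_compose[OF assms(1,2) _ assms(4,5)]])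

lemma djet_compose:
  assumes "comparable b" "djet n f" "djet n a" "djet n b"
  shows "djet n (\<lambda>z. f (a z, b z))"
proof -
  obtain p q where f: "has_partials f p q" "jet tempered n p" "jet tempered n q"
    using assms(2) by (rule djetE)
  obtain a1 a2 where a: "has_partials a a1 a2" "jet tempered n a1" "jet tempered n a2"
    using assms(3) by (rule djetE)
  obtain b1 b2 where b: "has_partials b b1 b2" "jet tempered n b1" "jet tempered n b2"
    using assms(4) by (rule djetE)
  have "jet tempered n (\<lambda>z. p (a z, b z) * a1 z + q (a z, b z) * b1 z)"
    "jet tempered n (\<lambda>z. p (a z, b z) * a2 z + q (a z, b z) * b2 z)"
    by (intro jet_add jet_mult jet_compose assms f a b; simp)+
  then show ?thesis
    using has_partials_compose[OF f(1) a(1) b(1) comparable_pos[OF assms(1)]]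
    unfolding djet_def by blast
qed

text \<open>Nonvanishing gives no uniform lower bound, so the growth of the reciprocal is assumed at
  order 0. Higher orders follow from \<open>(1/f)' = - (1/f)^2 * f'\<close>.\<close>

lemma jet_inverse:
  assumes "tempered (\<lambda>z. inverse (f z))" "\<And>z. snd z > 0 \<Longrightarrow> f z \<noteq> 0"
  shows "jet tempered n f \<Longrightarrow> jet tempered n (\<lambda>z. inverse (f z))"
proof (induction n)
  case 0
  then show ?case using assms by simp
next
  case (Suc n)
  then obtain p q where f: "has_partials f p q" "jet tempered n p" "jet tempered n q"
    by (elim jet_SucE)
  have "((inverse :: real \<Rightarrow> real) has_real_derivative - (inverse (f z) * inverse (f z))) (at (f z))"
    if "snd z > 0" for z
    using DERIV_inverse[OF assms(2)[OF that]] by (simp add: power2_eq_square power_Suc)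
  from has_partials_real[of inverse "\<lambda>t. - (inverse t * inverse t)" f, OF this f(1)]
  have "has_partials (\<lambda>z. inverse (f z)) (\<lambda>z. - (inverse (f z) * inverse (f z)) * p z)
     (\<lambda>z. - (inverse (f z) * inverse (f z)) * q z)" by simp
  moreover have i: "jet tempered n (\<lambda>z. inverse (f z))" using Suc jet_SucD by blast
  have "jet tempered n (\<lambda>z. (-1) * (inverse (f z) * inverse (f z)) * p z)"
     "jet tempered n (\<lambda>z. (-1) * (inverse (f z) * inverse (f z)) * q z)"
    by (intro jet_mult jet_const i f; simp)+
  ultimately show ?case
    by (intro jet_SucI[where p = "\<lambda>z. - (inverse (f z) * inverse (f z)) * p z"
          and q = "\<lambda>z. - (inverse (f z) * inverse (f z)) * q z"])
      (simp_all add: assms(1))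
qed

text \<open>Mean value inequality on a horizontal segment: all its points have height
  \<open>b z\<close>, so the tempered bound on the first partial is constant along it, and the
  difference is at most \<open>d\<close> times a tempered function.\<close>

lemma rapid_shift_diff:
  assumes b: "comparable b" and f: "djet 0 f" and d: "rapid d"
  shows "rapid (\<lambda>z. f (a z + d z, b z) - f (a z, b z))"
proof -
  obtain p q where pq: "has_partials f p q" "tempered p" using f unfolding djet_def by auto
  obtain N C where p: "\<And>z. snd z > 0 \<Longrightarrow> \<bar>p z\<bar> \<le> C * weight (snd z) ^ N"
    using pq(2) unfolding tempered_def by metis
  have le: "\<bar>f (a z + d z, b z) - f (a z, b z)\<bar> \<le> \<bar>d z * (\<bar>C\<bar> * (3 * weight (snd z)) ^ N)\<bar>"
    if z: "snd z > 0" for z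
  proof -
    have bz: "b z > 0" using b z comparable_pos by blast
    have der: "((\<lambda>t. f (t, b z)) has_real_derivative p (t, b z)) (at t within UNIV)" for t
    proof -
      have "((\<lambda>t. (t, b z)) has_derivative (\<lambda>v. (v, 0))) (at t)"
        by (auto intro!: derivative_eq_intros)
      from has_derivative_compose[OF this has_partialsD[OF pq(1)]] bz
      show ?thesis unfolding has_field_derivative_def by simp
    qed
    have "norm (p (t, b z)) \<le> \<bar>C\<bar> * (3 * weight (snd z)) ^ N" for t
    proof -
      have "\<bar>p (t, b z)\<bar> \<le> C * weight (b z) ^ N" using p[of "(t, b z)"] bz by simp
      also have "\<dots> \<le> \<bar>C\<bar> * (3 * weight (snd z)) ^ N"
        using weight_comparable[OF b z] weight_ge_1[OF bz] by (intro mult_mono power_mono) auto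
      finally show ?thesis by simp
    qed
    from field_differentiable_bound[OF convex_UNIV der this, of "a z + d z" "a z"]
    show ?thesis using weight_ge_1[OF z] by (simp add: abs_mult mult.commute)
  qed
  have "rapid (\<lambda>z. d z * (\<bar>C\<bar> * (3 * weight (snd z)) ^ N))"
  proof (intro rapid_mult d)
    have "\<bar>\<bar>C\<bar> * (3 * weight (snd z)) ^ N\<bar> \<le> (\<bar>C\<bar> * 3 ^ N) * weight (snd z) ^ N"
      if "snd z > 0" for z
      using weight_ge_1[OF that] by (simp add: abs_mult power_mult_distrib)
    then show "tempered (\<lambda>z. \<bar>C\<bar> * (3 * weight (snd z)) ^ N)" unfolding tempered_def by blast
  qed
  then show ?thesis by (rule rapid_mono) (rule le)
qed

text \<open>Differentiating the difference gives differences of the same kind for the partials of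
  \<open>f\<close>, multiplied by tempered factors, and terms containing a derivative of
  \<open>d\<close>.\<close>

lemma jet_rapid_shift_diff:
  assumes b: "comparable b"
  shows "djet n f \<Longrightarrow> djet n a \<Longrightarrow> djet n b \<Longrightarrow> jet rapid (Suc n) d \<Longrightarrow>
    jet rapid n (\<lambda>z. f (a z + d z, b z) - f (a z, b z))"
proof (induction n arbitrary: f)
  case 0
  then show ?case using rapid_shift_diff[OF b] by auto
next
  case (Suc n)
  have base: "rapid (\<lambda>z. f (a z + d z, b z) - f (a z, b z))"
  proof (rule rapid_shift_diff[OF b])
    show "djet 0 f" using Suc.prems(1) jet_base unfolding djet_def by fastforce
    show "rapid d" using Suc.prems(4) by auto
  qed
  obtain p q where f: "has_partials f p q" "jet tempered (Suc n) p" "jet tempered (Suc n) q"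
    using Suc.prems unfolding djet_def by auto
  obtain a1 a2 where a: "has_partials a a1 a2" "jet tempered n a1" "jet tempered n a2"
    using djet_SucD[OF Suc.prems(2)] unfolding djet_def by auto
  obtain b1 b2 where b12: "has_partials b b1 b2" "jet tempered n b1" "jet tempered n b2"
    using djet_SucD[OF Suc.prems(3)] unfolding djet_def by auto
  have dS: "jet rapid (Suc n) d" using Suc.prems(4) jet_SucD by blast
  then obtain d1 d2 where d: "has_partials d d1 d2" "jet rapid n d1" "jet rapid n d2"
    by auto
  have dd: "djet n d" using dS jet_rapid_imp_tempered jet_tempered_imp_djet by blast
  let ?a = "\<lambda>z. a z + d z"
  have an: "djet n a" "djet n b" using djet_SucD Suc.prems by blast+
  have da: "djet n ?a" by (intro djet_add an dd)
  let ?X = "\<lambda>p z. p (a z + d z, b z)"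
  have bpos: "\<And>z. snd z > 0 \<Longrightarrow> b z > 0" using b comparable_pos by blast
  \<comment> \<open>The difference is written as a sum with coefficient -1, so that the rules for
    sums and products apply.\<close>
  have part: "has_partials (\<lambda>z. f (?a z, b z) + (-1) * f (a z, b z))
     (\<lambda>z. (p (?a z, b z) * (a1 z + d1 z) + q (?a z, b z) * b1 z) +
          (0 * f (a z, b z) + (-1) * (p (a z, b z) * a1 z + q (a z, b z) * b1 z)))
     (\<lambda>z. (p (?a z, b z) * (a2 z + d2 z) + q (?a z, b z) * b2 z) +
          (0 * f (a z, b z) + (-1) * (p (a z, b z) * a2 z + q (a z, b z) * b2 z)))"
    by (intro has_partials_add has_partials_mult has_partials_const has_partials_compose
        f a b12 d bpos)
  have diff: "jet rapid n (\<lambda>z. h (?a z, b z) - h (a z, b z))" if "jet tempered (Suc n) h" for h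
    using Suc.IH[OF jet_tempered_imp_djet[OF that] an dS] .
  have comp: "jet tempered n (\<lambda>z. h (?a z, b z))" if "jet tempered (Suc n) h" for h
    using jet_compose[OF _ b jet_SucD[OF that] da an(2)] by simp
  \<comment> \<open>After regrouping, every summand has a rapid factor: a difference covered by the
    induction hypothesis, or a derivative of \<open>d\<close>.\<close>
  have J: "jet rapid n (\<lambda>z. ((p (?a z, b z) - p (a z, b z)) * a' z + d' z * p (?a z, b z))
      + (q (?a z, b z) - q (a z, b z)) * b' z)"
    if "jet tempered n a'" "jet tempered n b'" "jet rapid n d'" for a' b' d'
    by (intro jet_add jet_mult diff comp f that) simp_all
  have "jet rapid n (\<lambda>z. (p (?a z, b z) * (a' z + d' z) + q (?a z, b z) * b' z) +
          (0 * f (a z, b z) + (-1) * (p (a z, b z) * a' z + q (a z, b z) * b' z)))"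
    if "jet tempered n a'" "jet tempered n b'" "jet rapid n d'" for a' b' d'
    by (rule jet_cong[OF J[OF that]]) (simp_all add: algebra_simps)
  from this[OF a(2) b12(2) d(2)] this[OF a(3) b12(3) d(3)] part base
  show ?case by auto
qed

section \<open>Extension by zero across the boundary\<close>

definition ext0 :: "(real \<times> real \<Rightarrow> real) \<Rightarrow> real \<times> real \<Rightarrow> real" where
  "ext0 f z = (if snd z > 0 then f z else 0)"

text \<open>Only the line \<open>y = 0\<close> needs an argument; rapid decrease makes the
  derivative vanish there, in agreement with the extension by zero of the partials.\<close>

lemma has_derivative_ext0:
  assumes "rapid f" "has_partials f p q"
  shows "(ext0 f has_derivative (\<lambda>v. ext0 p z * fst v + ext0 q z * snd v)) (at z)"
proof -
  consider "snd z > 0" | "snd z < 0" | "snd z = 0" by linarith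
  then show ?thesis
  proof cases
    case 1
    have "open {z :: real \<times> real. snd z > 0}" by (intro open_Collect_less continuous_intros)
    then have "(ext0 f has_derivative (\<lambda>v. p z * fst v + q z * snd v)) (at z)"
      by (rule has_derivative_transform_within_open[OF has_partialsD[OF assms(2) 1]])
        (use 1 in \<open>auto simp: ext0_def\<close>)
    then show ?thesis using 1 by (simp add: ext0_def)
  next
    case 2
    have "open {z :: real \<times> real. snd z < 0}" by (intro open_Collect_less continuous_intros)
    then have "(ext0 f has_derivative (\<lambda>v. 0)) (at z)"
      by (rule has_derivative_transform_within_open[OF has_derivative_const[of 0]])
        (use 2 in \<open>auto simp: ext0_def\<close>)
    then show ?thesis using 2 by (simp add: ext0_def)
  next
    case 3
    \<comment> \<open>Exponent 2 yields \<open>\<bar>f z\<bar> \<le> C * y^2\<close>, one power of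
      \<open>y\<close> more than the difference quotient consumes.\<close>
    obtain C where C: "\<And>z. snd z > 0 \<Longrightarrow> \<bar>f z\<bar> * weight (snd z) ^ 2 \<le> C"
      using assms(1) unfolding rapid_def by metis
    have bound: "\<bar>ext0 f x\<bar> \<le> \<bar>C\<bar> * (norm (x - z))\<^sup>2" for x
    proof (cases "snd x > 0")
      case True
      have y: "snd x \<le> norm (x - z)" using 3 norm_snd_le[of "snd (x - z)" "fst (x - z)"] True
        unfolding prod.collapse by simp
      have "1 / snd x \<le> weight (snd x)" using True by (simp add: weight_def)
      then have "(1 / snd x)\<^sup>2 \<le> (weight (snd x))\<^sup>2" using True by (intro power_mono) auto
      then have "\<bar>f x\<bar> * (1 / snd x)\<^sup>2 \<le> \<bar>f x\<bar> * (weight (snd x))\<^sup>2" by (intro mult_left_mono) auto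
      then have "\<bar>f x\<bar> * (1 / snd x)\<^sup>2 \<le> \<bar>C\<bar>" using C[OF True] by linarith
      then have "\<bar>f x\<bar> \<le> \<bar>C\<bar> * (snd x)\<^sup>2" using True by (simp add: field_simps)
      also have "\<dots> \<le> \<bar>C\<bar> * (norm (x - z))\<^sup>2"
        using y True by (intro mult_left_mono power_mono) auto
      finally show ?thesis using True by (simp add: ext0_def)
    qed (simp add: ext0_def)
    have "(ext0 f has_derivative (\<lambda>v. 0)) (at z within UNIV)"
    proof (rule has_derivativeI_sandwich[of 1 _ _ _ _ "\<lambda>x. \<bar>C\<bar> * norm (x - z)"])
      show "norm (ext0 f x - ext0 f z - 0) / norm (x - z) \<le> \<bar>C\<bar> * norm (x - z)"
        if "x \<noteq> z" for x
        using bound[of x] that 3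
          by (simp add: ext0_def[of f z] divide_simps power2_eq_square mult.assoc)
      show "((\<lambda>x. \<bar>C\<bar> * norm (x - z)) \<longlongrightarrow> 0) (at z within UNIV)"
        by (rule tendsto_eq_intros | simp)+
    qed simp_all
    then show ?thesis using 3 by (simp add: ext0_def)
  qed
qed

text \<open>The affine part is general so that the induction closes: the derivative in a fixed
  direction \<open>v\<close> has the same form, with constant \<open>L v\<close> and linear part 0.
  One extra order of the jets gives continuity at the last stage.\<close>

lemma Cn_on_affine_plus_ext0:
  assumes "bounded_linear L"
  shows "jet rapid (Suc n) f \<Longrightarrow> jet rapid (Suc n) g \<Longrightarrow>
    Cn_on n S (\<lambda>z. c + L z + (ext0 f z, ext0 g z))"
  using assms
proof (induction n arbitrary: f g c L)
  case 0
  obtain p q where f: "rapid f" "has_partials f p q" using 0(1) by (rule jet_SucE)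
  obtain r s where g: "rapid g" "has_partials g r s" using 0(2) by (rule jet_SucE)
  have "continuous_on S (ext0 f)" "continuous_on S (ext0 g)"
    by (rule has_derivative_continuous_on, rule has_derivative_at_withinI,
        rule has_derivative_ext0[OF f])
      (rule has_derivative_continuous_on, rule has_derivative_at_withinI,
        rule has_derivative_ext0[OF g])
  then show ?case
    unfolding Cn_on.simps
    by (intro continuous_on_add continuous_on_const continuous_on_Pair linear_continuous_on[OF
      0(3)])
next
  case (Suc n)
  obtain p q where f: "rapid f" "has_partials f p q" "jet rapid (Suc n) p" "jet rapid (Suc n) q"
    using Suc(2) by (rule jet_SucE)
  obtain r s where g: "rapid g" "has_partials g r s" "jet rapid (Suc n) r" "jet rapid (Suc n) s"
    using Suc(3) by (rule jet_SucE)
  let ?D = "\<lambda>z v. L v + (ext0 p z * fst v + ext0 q z * snd v, ext0 r z * fst v + ext0 s z * snd v)"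
  have "((\<lambda>z. c + L z + (ext0 f z, ext0 g z)) has_derivative ?D z) (at z within S)" for z
  proof -
    have "((\<lambda>z. c + L z + (ext0 f z, ext0 g z)) has_derivative (\<lambda>v. 0 + L v +
        (ext0 p z * fst v + ext0 q z * snd v, ext0 r z * fst v + ext0 s z * snd v))) (at z)"
      by (rule has_derivative_add[OF has_derivative_add[OF has_derivative_const
            bounded_linear_imp_has_derivative[OF Suc(4)]]
            has_derivative_Pair[OF has_derivative_ext0[OF f(1,2)] has_derivative_ext0[OF g(1,2)]]])
    then show ?thesis unfolding add_0 by (rule has_derivative_at_withinI)
  qed
  moreover have "Cn_on n S (\<lambda>z. ?D z v)" for v
  proof -
    have "Cn_on n S (\<lambda>z. L v + (\<lambda>_. 0) z +
        (ext0 (\<lambda>z. p z * fst v + q z * snd v) z, ext0 (\<lambda>z. r z * fst v + s z * snd v) z))"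
      by (rule Suc.IH) (intro jet_add jet_mult jet_const f g bounded_linear_zero; simp)+
    moreover have "ext0 (\<lambda>z. p z * fst v + q z * snd v) z = ext0 p z * fst v + ext0 q z * snd v"
      for p q z by (simp add: ext0_def)
    ultimately show ?thesis by simp
  qed
  ultimately show ?case unfolding Cn_on.simps by (intro exI[of _ ?D]) blast
qed

lemma Ck_on_id_plus_ext0:
  assumes "\<And>n. jet rapid n f" "\<And>n. jet rapid n g"
  shows "Ck_on k S (\<lambda>z. z + (ext0 f z, ext0 g z))"
  using Cn_on_affine_plus_ext0[OF bounded_linear_ident assms, of _ S 0]
  unfolding Ck_on_def by simp

section \<open>Cutoffs and shear profiles\<close>

text \<open>From \<open>(1 + s/n)^n \<le> exp s\<close>. This bounds both the functions
  \<open>flat\<close> and the powers of the weight times \<open>phi\<close>.\<close>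

lemma power_mult_exp_le:
  fixes s :: real assumes "s \<ge> 0"
  shows "s ^ n * exp (- s) \<le> real n ^ n"
proof (cases "n = 0")
  case True
  then show ?thesis using assms by simp
next
  case False
  have "(s / n) ^ n \<le> (1 + s / n) ^ n" using assms by (intro power_mono) auto
  also have "\<dots> \<le> exp s" using assms False by (intro exp_ge_one_plus_x_over_n_power_n) auto
  finally have "s ^ n \<le> n ^ n * exp s" using False by (simp add: power_divide field_simps)
  then show ?thesis by (simp add: exp_minus field_simps)
qed

text \<open>The classical smooth function \<open>exp (-1/t)\<close>, with powers of
  \<open>1/t\<close> as factors so that derivatives are linear combinations within the
  family.\<close>

definition flat :: "nat \<Rightarrow> real \<Rightarrow> real" where
  "flat m t = (if t > 0 then inverse t ^ m * exp (- inverse t) else 0)"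

lemma flat_nonneg: "flat m t \<ge> 0"
  by (simp add: flat_def)

lemma flat_le: "flat m t \<le> real m ^ m"
  using power_mult_exp_le[of "inverse t" m] by (simp add: flat_def)

lemma flat_has_derivative:
  "(flat m has_real_derivative flat (m + 2) t - real m * flat (m + 1) t) (at t)"
proof -
  consider "t > 0" | "t < 0" | "t = 0" by linarith
  then show ?thesis
  proof cases
    case 1
    have "((\<lambda>t. inverse t ^ m) has_real_derivative - real m * inverse t ^ (m + 1)) (at t)"
      using DERIV_power[OF DERIV_inverse, of t m UNIV] 1 by (cases m) (auto simp: algebra_simps)
    moreover have "((\<lambda>t. exp (- inverse t)) has_real_derivative
        inverse t ^ 2 * exp (- inverse t)) (at t)"
      using 1 by (auto intro!: derivative_eq_intros simp: power2_eq_square)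
    ultimately have "((\<lambda>t. inverse t ^ m * exp (- inverse t)) has_real_derivative
        - real m * inverse t ^ (m + 1) * exp (- inverse t) +
        inverse t ^ 2 * exp (- inverse t) * inverse t ^ m) (at t)"
      by (rule DERIV_mult)
    moreover have "- real m * inverse t ^ (m + 1) * exp (- inverse t) +
        inverse t ^ 2 * exp (- inverse t) * inverse t ^ m =
          flat (m + 2) t - real m * flat (m + 1) t"
      using 1 by (simp add: flat_def power2_eq_square algebra_simps)
    ultimately have "((\<lambda>t. inverse t ^ m * exp (- inverse t)) has_real_derivative
        flat (m + 2) t - real m * flat (m + 1) t) (at t)" by (simp only:)
    then show ?thesis
      by (rule has_field_derivative_transform_within_open[of _ _ _ "{0<..}"])
        (use 1 in \<open>auto simp: flat_def\<close>)
  next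
    case 2
    have "((\<lambda>t. 0) has_real_derivative flat (m + 2) t - real m * flat (m + 1) t) (at t)"
      using 2 by (auto simp: flat_def)
    then show ?thesis
      by (rule has_field_derivative_transform_within_open[of _ _ _ "{..<0}"])
        (use 2 in \<open>auto simp: flat_def\<close>)
  next
    case 3
    let ?K = "real (m + 2) ^ (m + 2)"
    have bound: "norm ((flat m h - flat m 0) / (h - 0)) \<le> \<bar>h\<bar> * ?K" if "h \<noteq> 0" for h
    proof (cases "h > 0")
      case True
      \<comment> \<open>Two powers of \<open>h\<close> are traded for a larger index; since
        \<open>flat (m + 2)\<close> is bounded, the difference quotient is of order
        \<open>h\<close>.\<close>
      have "flat m h = flat (m + 2) h * h * h" using True by (simp add: flat_def field_simps)
      then show ?thesis using True flat_le[of "m + 2" h] flat_nonneg[of "m + 2" h]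
        by (simp add: flat_def[of m 0] abs_mult)
    next
      case False
      then have "flat m h = 0" "flat m 0 = 0" by (simp_all add: flat_def)
      then have "norm ((flat m h - flat m 0) / (h - 0)) = 0" by simp
      also have "0 \<le> \<bar>h\<bar> * ?K" by (intro mult_nonneg_nonneg zero_le_power) simp_all
      finally show ?thesis .
    qed
    have lim: "((\<lambda>h. \<bar>h\<bar> * ?K) \<longlongrightarrow> 0) (at 0)"
      by (rule tendsto_eq_intros | simp)+
    have "((\<lambda>h. (flat m h - flat m 0) / (h - 0)) \<longlongrightarrow> 0) (at 0)"
      by (rule Lim_null_comparison[OF eventually_mono[OF eventually_neq_at_within bound] lim])
    moreover have "flat (m + 2) 0 - real m * flat (m + 1) 0 = 0" by (simp add: flat_def)
    ultimately show ?thesis unfolding 3 has_field_derivative_iff by (simp only:)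
  qed
qed

lemma jet_flat: "jet tempered n (\<lambda>z. flat m (c + s * snd z))"
proof (induction n arbitrary: m)
  case 0
  have "\<forall>z. snd z > 0 \<longrightarrow> \<bar>flat m (c + s * snd z)\<bar> \<le> real m ^ m * weight (snd z) ^ 0"
    using flat_nonneg flat_le by auto
  then show ?case unfolding tempered_def jet.simps by blast
next
  case (Suc n)
  let ?a = "\<lambda>z :: real \<times> real. c + s * snd z"
  have "has_partials ?a (\<lambda>z. 0 + (0 * snd z + s * 0)) (\<lambda>z. 0 + (0 * snd z + s * 1))"
    by (intro has_partials_add has_partials_mult has_partials_const has_partials_snd)
  then have a: "has_partials ?a (\<lambda>z. 0) (\<lambda>z. s)" by simp
  have "jet tempered n (\<lambda>z. flat (m + 2) (?a z) + - real m * flat (m + 1) (?a z))"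
    by (rule jet_add[OF _ Suc jet_mult[OF _ jet_const Suc]]) simp_all
  then have D: "jet tempered n (\<lambda>z. flat (m + 2) (?a z) - real m * flat (m + 1) (?a z))"
    by simp
  have "jet tempered n (\<lambda>z. flat m (?a z))" by (rule Suc)
  then have "tempered (\<lambda>z. flat m (?a z))" by (rule jet_base)
  then show ?case
    by (rule jet_SucI[OF _ has_partials_real[OF flat_has_derivative a]
          jet_mult[OF _ D jet_const] jet_mult[OF _ D jet_const]]) simp_all
qed

definition cutoff :: "real \<Rightarrow> real" where
  "cutoff y = flat 0 (1/2 - y) / (flat 0 (1/2 - y) + flat 0 (y - 1/8))"

lemma flat_0_mono: "s \<le> t \<Longrightarrow> flat 0 s \<le> flat 0 t"
  by (auto simp: flat_def)

text \<open>The point 5/16 is the midpoint of 1/8 and 1/2, so at least one of the two arguments is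
  3/16 or larger.\<close>

lemma cutoff_denominator: "flat 0 (1/2 - y) + flat 0 (y - 1/8) \<ge> flat 0 (3/16)"
  using flat_0_mono[of "3/16" "1/2 - y"] flat_0_mono[of "3/16" "y - 1/8"]
    flat_nonneg[of 0 "1/2 - y"] flat_nonneg[of 0 "y - 1/8"]
  by (cases "y \<le> 5/16") auto

lemma flat_pos: "t > 0 \<Longrightarrow> flat 0 t > 0"
  by (simp add: flat_def)

lemma cutoff_eq_1: "y \<le> 1/8 \<Longrightarrow> cutoff y = 1"
  using flat_pos[of "1/2 - y"] by (simp add: cutoff_def flat_def[of 0 "y - 1/8"])

lemma cutoff_eq_0: "y \<ge> 1/2 \<Longrightarrow> cutoff y = 0"
  by (simp add: cutoff_def flat_def)

lemma tempered_bounded: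
  assumes "\<And>z. snd z > 0 \<Longrightarrow> \<bar>f z\<bar> \<le> C"
  shows "tempered f"
  unfolding tempered_def using assms by (intro exI[of _ 0] exI[of _ C]) auto

lemma jet_cutoff: "jet tempered n (\<lambda>z. cutoff (snd z))"
proof -
  let ?d = "\<lambda>z :: real \<times> real. flat 0 (1/2 - snd z) + flat 0 (snd z - 1/8)"
  have d: "?d z \<ge> flat 0 (3/16)" for z by (rule cutoff_denominator)
  have e: "flat 0 (3/16) > 0" by (rule flat_pos) simp
  have 1: "jet tempered n (\<lambda>z. flat 0 (1/2 - snd z))" "jet tempered n (\<lambda>z. flat 0 (snd z - 1/8))"
    using jet_flat[of n 0 "1/2" "-1"] jet_flat[of n 0 "-1/8" 1] by simp_all
  have "\<bar>inverse (?d z)\<bar> \<le> inverse (flat 0 (3/16))" for z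
    using d[of z] e by (simp add: le_imp_inverse_le)
  then have t: "tempered (\<lambda>z. inverse (?d z))" by (rule tempered_bounded)
  have nz: "?d z \<noteq> 0" for z using d[of z] e by linarith
  have inv: "jet tempered n (\<lambda>z. inverse (?d z))"
    by (rule jet_inverse[OF t nz jet_add[OF _ 1]]) simp
  have "jet tempered n (\<lambda>z. flat 0 (1/2 - snd z) * inverse (?d z))"
    by (rule jet_mult[OF _ 1(1) inv]) simp
  moreover have "(\<lambda>z. cutoff (snd z)) = (\<lambda>z. flat 0 (1/2 - snd z) * inverse (?d z))"
    by (rule ext) (simp only: cutoff_def, rule divide_inverse)
  ultimately show ?thesis by (simp only:)
qed

lemma jet_snd: "jet tempered n snd"
proof -
  have "\<forall>z. snd z > 0 \<longrightarrow> \<bar>snd z\<bar> \<le> 1 * weight (snd z) ^ 1" by (auto simp: weight_def)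
  then have "tempered snd" unfolding tempered_def by blast
  then show ?thesis
    by (cases n) (auto simp del: jet.simps(2) intro!: jet_SucI has_partials_snd jet_const)
qed

lemma jet_inverse_snd: "jet tempered n (\<lambda>z. inverse (snd z))"
proof (rule jet_inverse[OF _ _ jet_snd])
  have "\<forall>z. snd z > 0 \<longrightarrow> \<bar>inverse (snd z)\<bar> \<le> 1 * weight (snd z) ^ 1"
    by (auto simp: weight_def divide_inverse)
  then show "tempered (\<lambda>z. inverse (snd z))" unfolding tempered_def by blast
qed auto

lemma jet_ln_snd: "jet tempered n (\<lambda>z. ln (snd z))"
proof -
  \<comment> \<open>The inequality \<open>ln u \<le> u - 1\<close> at \<open>u = y\<close> and at
    \<open>u = 1/y\<close> bounds the logarithm from both sides.\<close>
  have "\<bar>ln y\<bar> \<le> 1 * weight y ^ 1" if "y > 0" for y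
  proof -
    have "ln y \<le> y - 1" by (rule ln_le_minus_one[OF that])
    moreover have "ln (1 / y) \<le> 1 / y - 1" by (rule ln_le_minus_one) (simp add: that)
    ultimately show ?thesis using that
      by (simp add: weight_def ln_div abs_le_iff) (smt (verit) divide_pos_pos)
  qed
  then have t: "tempered (\<lambda>z. ln (snd z))" unfolding tempered_def by blast
  have "has_partials (\<lambda>z. ln (snd z)) (\<lambda>z. inverse (snd z) * 0) (\<lambda>z. inverse (snd z) * 1)"
    by (rule has_partials_real[OF _ has_partials_snd])
      (auto intro!: derivative_eq_intros simp: divide_inverse)
  then have "jet tempered (Suc n) (\<lambda>z. ln (snd z))"
    by (rule jet_SucI[where B = tempered, OF t]) (simp_all add: jet_const jet_inverse_snd)
  then show ?thesis by (rule jet_SucD)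
qed

definition psi :: "real \<Rightarrow> real" where "psi y = 7 * ln y * cutoff y"

lemma psi_small: "y \<le> 1/8 \<Longrightarrow> psi y = 7 * ln y" and psi_large: "y \<ge> 1/2 \<Longrightarrow> psi y = 0"
  by (simp_all add: psi_def cutoff_eq_1 cutoff_eq_0)

lemma jet_psi: "jet tempered n (\<lambda>z. psi (snd z))"
  unfolding psi_def by (intro jet_mult jet_const jet_ln_snd jet_cutoff) simp_all

definition phi :: "real \<Rightarrow> real" where "phi y = exp (- weight y)"

lemma phi_pos: "phi y > 0"
  by (simp add: phi_def)

text \<open>The derivative is \<open>phi\<close> times \<open>1/y^2 - 1\<close>, a rapid function
  times a tempered one, so the induction reproduces itself.\<close>

lemma jet_phi: "jet rapid n (\<lambda>z. phi (snd z))"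
proof (induction n)
  have "\<bar>phi (snd z)\<bar> * weight (snd z) ^ N \<le> real N ^ N" if "snd z > 0" for z :: "real \<times> real" and N
    using power_mult_exp_le[of "weight (snd z)" N] weight_ge_1[OF that]
      by (simp add: phi_def mult.commute)
  then have r: "rapid (\<lambda>z. phi (snd z))" unfolding rapid_def by blast
  {
    case 0
    then show ?case using r by simp
  next
    case (Suc n)
    let ?h = "\<lambda>y. phi y * (inverse y * inverse y - 1)"
    have "(phi has_real_derivative ?h y) (at y)" if "y > 0" for y
    proof -
      have "(weight has_real_derivative 1 - inverse y * inverse y) (at y)"
        unfolding weight_def using that
        by (auto intro!: derivative_eq_intros simp: divide_inverse power2_eq_square)
      then show ?thesis
        unfolding phi_def by (auto intro!: derivative_eq_intros simp: algebra_simps)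
    qed
    from has_partials_real[OF this has_partials_snd]
    have "has_partials (\<lambda>z. phi (snd z)) (\<lambda>z. ?h (snd z) * 0) (\<lambda>z. ?h (snd z) * 1)" by simp
    moreover have "jet tempered n (\<lambda>z. inverse (snd z) * inverse (snd z) + (- 1))"
      by (intro jet_add jet_mult jet_const jet_inverse_snd) simp_all
    from jet_mult[OF _ Suc this] have "jet rapid n (\<lambda>z. ?h (snd z))" by simp
    from jet_mult[OF _ this jet_const] have "jet rapid n (\<lambda>z. ?h (snd z) * c)" for c by simp
    ultimately show ?case using r by (intro jet_SucI)
  }
qed

section \<open>The conjugated shear\<close>

text \<open>The function \<open>g'\<close> of the overview; \<open>circ\<close> below is
  \<open>g\<close>.\<close>

definition speed :: "real \<Rightarrow> real" where "speed x = 1 + cos (2 * pi * x) / 2"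

definition circ :: "real \<Rightarrow> real" where "circ x = x + sin (2 * pi * x) / (4 * pi)"

definition circ_inv :: "real \<Rightarrow> real" where "circ_inv = inv circ"

section \<open>The circle diffeomorphism and its inverse\<close>

lemma speed_ge: "speed x \<ge> 1/2" and speed_le: "speed x \<le> 3/2"
  using cos_ge_minus_one[of "2 * pi * x"] cos_le_one[of "2 * pi * x"]
  unfolding speed_def by linarith+

lemma speed_pos: "speed x > 0"
  using speed_ge[of x] by linarith

lemma circ_has_derivative: "(circ has_real_derivative speed x) (at x)"
  unfolding circ_def speed_def by (auto intro!: derivative_eq_intros simp: field_simps)

lemma speed_has_derivative: "(speed has_real_derivative - (pi * sin (2 * pi * x))) (at x)"
  unfolding speed_def by (auto intro!: derivative_eq_intros simp: field_simps)

lemma circ_less: "x < y \<Longrightarrow> circ x < circ y"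
  by (rule DERIV_pos_imp_increasing) (use circ_has_derivative speed_pos in blast)+

lemma circ_less_iff: "circ x < circ y \<longleftrightarrow> x < y"
  using circ_less[of x y] circ_less[of y x] by (cases x y rule: linorder_cases) auto

lemma continuous_circ: "continuous_on S circ"
  by (rule DERIV_continuous_on, rule has_field_derivative_at_within, rule circ_has_derivative)

lemma circ_near: "\<bar>circ x - x\<bar> \<le> 1"
proof -
  have "\<bar>sin (2 * pi * x)\<bar> \<le> 4 * pi" using abs_sin_le_one[of "2 * pi * x"] pi_gt3 by linarith
  then show ?thesis by (simp add: circ_def abs_mult)
qed

text \<open>Surjectivity by the intermediate value theorem, since \<open>circ\<close> stays within
  distance 1 of the identity.\<close>

lemma circ_circ_inv [simp]: "circ (circ_inv y) = y"
proof -
  have "\<exists>x. y - 1 \<le> x \<and> x \<le> y + 1 \<and> circ x = y"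
    by (rule IVT') (use circ_near[of "y - 1"] circ_near[of "y + 1"] continuous_circ in auto)
  then show ?thesis unfolding circ_inv_def by (metis f_inv_into_f rangeI)
qed

lemma circ_inv_circ [simp]: "circ_inv (circ x) = x"
  using circ_less_iff by (metis circ_circ_inv less_irrefl linorder_neqE_linordered_idom)

lemma circ_inv_less_iff: "circ_inv x < circ_inv y \<longleftrightarrow> x < y"
  by (metis circ_circ_inv circ_less_iff)

lemma isCont_circ_inv: "isCont circ_inv y"
proof -
  have "isCont circ_inv (circ (circ_inv y))"
    by (rule isCont_inverse_function2[of "circ_inv y - 1" _ "circ_inv y + 1"])
      (auto intro: DERIV_isCont[OF circ_has_derivative])
  then show ?thesis by simp
qed

lemma circ_inv_has_derivative: "(circ_inv has_real_derivative inverse (speed (circ_inv y))) (at y)"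
  by (rule DERIV_inverse_function[OF circ_has_derivative _ _ _ _ isCont_circ_inv, of _ "y - 1"
    "y + 1"])
    (use speed_pos[of "circ_inv y"] in auto)

lemma speed_periodic: "speed (x + of_int n) = speed x"
  using cos_int_2pin[of n] sin_int_2pin[of n] by (simp add: speed_def distrib_left cos_add)

lemma circ_translate: "circ (x + of_int n) = circ x + of_int n"
  using cos_int_2pin[of n] sin_int_2pin[of n] by (simp add: circ_def distrib_left sin_add)

lemma circ_inv_translate: "circ_inv (y + of_int n) = circ_inv y + of_int n"
  by (metis circ_circ_inv circ_translate circ_inv_circ)

text \<open>The phase \<open>c\<close> is general because differentiation shifts it by
  \<open>pi / 2\<close>.\<close>

lemma jet_cos: "jet tempered n (\<lambda>z. cos (2 * pi * fst z + c))"
proof (induction n arbitrary: c)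
  case 0
  show ?case by (simp add: tempered_bounded[of _ 1])
next
  case (Suc n)
  let ?a = "\<lambda>z :: real \<times> real. 2 * pi * fst z + c"
  have "has_partials ?a (\<lambda>z. (0 * fst z + 2 * pi * 1) + 0) (\<lambda>z. (0 * fst z + 2 * pi * 0) + 0)"
    by (intro has_partials_add has_partials_mult has_partials_const has_partials_fst)
  then have a: "has_partials ?a (\<lambda>z. 2 * pi) (\<lambda>z. 0)" by simp
  have d: "(cos has_real_derivative cos (t + pi / 2)) (at t)" for t :: real
    by (auto intro!: derivative_eq_intros simp: cos_add)
  have D: "jet tempered n (\<lambda>z. cos (?a z + pi / 2))"
    using Suc[of "c + pi / 2"] by (simp add: add.assoc)
  have "tempered (\<lambda>z. cos (?a z))" by (simp add: tempered_bounded[of _ 1])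
  then show ?case
    by (rule jet_SucI[where B = tempered, OF _ has_partials_real[OF d a]
          jet_mult[OF _ D jet_const] jet_mult[OF _ D jet_const]]) simp_all
qed

lemma jet_speed: "jet tempered n (\<lambda>z. speed (fst z))"
proof -
  have "jet tempered n (\<lambda>z. 1 + cos (2 * pi * fst z + 0) * (1/2))"
    by (rule jet_add[OF _ jet_const jet_mult[OF _ jet_cos jet_const]]) simp_all
  then show ?thesis by (simp add: speed_def)
qed

lemma abs_inverse_speed_le: "\<bar>inverse (speed x)\<bar> \<le> 2"
  using speed_ge[of x] by (simp add: divide_simps)

lemma jet_inverse_speed: "jet tempered n (\<lambda>z. inverse (speed (fst z)))"
proof (rule jet_inverse[OF tempered_bounded _ jet_speed])
  show "\<bar>inverse (speed (fst z))\<bar> \<le> 2" for z :: "real \<times> real" by (rule abs_inverse_speed_le)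
  show "speed (fst z) \<noteq> 0" for z :: "real \<times> real" using speed_pos[of "fst z"] by linarith
qed

lemma djet_circ: "djet n (\<lambda>z. circ (fst z))"
proof -
  have "has_partials (\<lambda>z. circ (fst z)) (\<lambda>z. speed (fst z) * 1) (\<lambda>z. speed (fst z) * 0)"
    by (rule has_partials_real[OF circ_has_derivative has_partials_fst])
  moreover have "jet tempered n (\<lambda>z. speed (fst z) * c)" for c
    by (rule jet_mult[OF _ jet_speed jet_const]) simp
  ultimately show ?thesis unfolding djet_def by blast
qed

lemma comparable_snd: "comparable snd"
  by (simp add: comparable_def)

text \<open>A bootstrap: the derivative of \<open>circ_inv\<close> is the reciprocal of
  \<open>speed\<close> along \<open>circ_inv\<close> itself. By \<open>jet_Suc_compose\<close>,
  order \<open>n\<close> of \<open>circ_inv\<close> gives order \<open>n + 1\<close> of this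
  derivative.\<close>

lemma djet_circ_inv: "djet n (\<lambda>z. circ_inv (fst z))"
proof -
  have hp: "has_partials (\<lambda>z. circ_inv (fst z)) (\<lambda>z. inverse (speed (circ_inv (fst z))) * 1)
      (\<lambda>z. inverse (speed (circ_inv (fst z))) * 0)"
    by (rule has_partials_real[OF circ_inv_has_derivative has_partials_fst])
  have step: "djet n (\<lambda>z. circ_inv (fst z))"
    if "jet tempered n (\<lambda>z. inverse (speed (circ_inv (fst z))))" for n
  proof -
    have "jet tempered n (\<lambda>z. inverse (speed (circ_inv (fst z))) * c)" for c
      by (rule jet_mult[OF _ that jet_const]) simp
    then show ?thesis using hp unfolding djet_def by blast
  qed
  show ?thesis
  proof (induction n)
    case 0
    show ?case by (rule step) (simp add: tempered_bounded[OF abs_inverse_speed_le])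
  next
    case (Suc n)
    show ?case
      by (rule step) (use jet_Suc_compose[OF _ comparable_snd jet_inverse_speed Suc djet_snd] in
        simp)
  qed
qed

text \<open>The map \<open>P\<close> of the overview, the cotangent lift of \<open>circ\<close>;
  dividing the height by the derivative keeps the area.\<close>

definition stretch :: "real \<times> real \<Rightarrow> real \<times> real" where
  "stretch z = (circ (fst z), snd z / speed (fst z))"

definition unstretch :: "real \<times> real \<Rightarrow> real \<times> real" where
  "unstretch z = (circ_inv (fst z), snd z * speed (circ_inv (fst z)))"

definition shear :: "(real \<Rightarrow> real) \<Rightarrow> real \<Rightarrow> real \<times> real \<Rightarrow> real \<times> real" where
  "shear h s z = (fst z + s * h (snd z), snd z)"

text \<open>\<open>s = 1\<close> gives \<open>G\<close> and \<open>s = -1\<close> its inverse, so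
  most facts about the two are proved together.\<close>

definition conj_map :: "real \<Rightarrow> real \<times> real \<Rightarrow> real \<times> real" where
  "conj_map s z = stretch (shear psi s (unstretch z))"

text \<open>\<open>c = 1\<close> gives the map \<open>F\<close> of the overview, and
  \<open>-c\<close> gives the inverse for \<open>c\<close>. Being the identity for
  \<open>y \<le> 0\<close>, the map is the identity plus an extension by zero.\<close>

definition twist_lift :: "real \<Rightarrow> real \<times> real \<Rightarrow> real \<times> real" where
  "twist_lift c z = (if snd z > 0 then conj_map (-1) (shear phi c (conj_map 1 z)) else z)"

lemma stretch_unstretch [simp]: "stretch (unstretch z) = z"
  using speed_pos[of "circ_inv (fst z)"] by (simp add: stretch_def unstretch_def)

lemma unstretch_stretch [simp]: "unstretch (stretch z) = z"
  using speed_pos[of "fst z"] by (simp add: stretch_def unstretch_def)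

lemma shear_shear: "shear h s (shear h t z) = shear h (s + t) z"
  by (simp add: shear_def algebra_simps)

lemma shear_0 [simp]: "shear h 0 z = z"
  by (simp add: shear_def)

lemma conj_map_inverse [simp]: "conj_map (-1) (conj_map 1 z) = z" "conj_map 1 (conj_map (-1) z) = z"
  by (simp_all add: conj_map_def shear_shear)

lemma snd_conj_map:
  "snd (conj_map s z) = snd z * (speed (circ_inv (fst z)) /
    speed (circ_inv (fst z) + s * psi (snd z * speed (circ_inv (fst z)))))"
  by (simp add: conj_map_def stretch_def shear_def unstretch_def)

lemma comparable_conj_map: "comparable (\<lambda>z. snd (conj_map s z))"
  unfolding comparable_def
proof (intro allI impI)
  fix z :: "real \<times> real" assume z: "snd z > 0"
  define a b where "a = speed (circ_inv (fst z))"
    and "b = speed (circ_inv (fst z) + s * psi (snd z * speed (circ_inv (fst z))))"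
  have "1/3 \<le> a / b" "a / b \<le> 3"
    using speed_ge speed_le speed_pos unfolding a_def b_def
    by (simp_all add: divide_simps) (smt (verit) speed_ge speed_le)+
  then have "snd z * (1/3) \<le> snd z * (a / b)" "snd z * (a / b) \<le> snd z * 3"
    using z by (intro mult_left_mono; simp)+
  then show "snd z / 3 \<le> snd (conj_map s z) \<and> snd (conj_map s z) \<le> 3 * snd z"
    unfolding snd_conj_map a_def b_def by (simp add: mult.commute)
qed

lemma snd_conj_map_pos: "snd z > 0 \<Longrightarrow> snd (conj_map s z) > 0"
  using comparable_pos[OF comparable_conj_map] by blast

text \<open>Since \<open>speed\<close> is at least 1/2, the height after \<open>unstretch\<close> is
  at least 1/2, where \<open>psi\<close> vanishes.\<close>

lemma conj_map_large: "snd z \<ge> 1 \<Longrightarrow> conj_map s z = z"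
proof -
  assume z: "snd z \<ge> 1"
  have "snd z * speed (circ_inv (fst z)) \<ge> 1 * (1/2)"
    using z speed_ge by (intro mult_mono) auto
  then have "psi (snd z * speed (circ_inv (fst z))) = 0" by (intro psi_large) simp
  then have "shear psi s (unstretch z) = unstretch z" by (simp add: shear_def unstretch_def)
  then show ?thesis by (simp add: conj_map_def)
qed

lemma conj_map_translate: "conj_map s (x + of_int n, y) = conj_map s (x, y) + (of_int n, 0)"
proof -
  have "circ (circ_inv x + of_int n + t) = circ (circ_inv x + t) + of_int n"
    "speed (circ_inv x + of_int n + t) = speed (circ_inv x + t)" for t
    using circ_translate[of "circ_inv x + t" n] speed_periodic[of "circ_inv x + t" n]
      by (simp_all add: add_ac)
  then show ?thesis by (simp add: conj_map_def stretch_def unstretch_def shear_def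
    circ_inv_translate speed_periodic)
qed

lemma djet_conj_map: "djet n (\<lambda>z. fst (conj_map s z))" "djet n (\<lambda>z. snd (conj_map s z))"
proof -
  let ?q1 = "\<lambda>z :: real \<times> real. circ_inv (fst z)" and ?q2 = "\<lambda>z. snd z * speed (circ_inv (fst z))"
  have q1: "djet n ?q1" by (rule djet_circ_inv)
  have "jet tempered m (\<lambda>z. speed (circ_inv (fst z)))" for m
    using jet_compose[OF _ comparable_snd jet_speed djet_circ_inv djet_snd, of m] by simp
  from jet_mult[OF _ jet_snd this] have "jet tempered m ?q2" for m by simp
  then have q2: "djet n ?q2" by (rule jet_tempered_imp_djet)
  have "snd z * (1/3) \<le> ?q2 z \<and> ?q2 z \<le> snd z * 3" if "snd z > 0" for z
    using that speed_ge[of "circ_inv (fst z)"] speed_le[of "circ_inv (fst z)"]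
    by (intro conjI mult_left_mono) auto
  then have c: "comparable ?q2" unfolding comparable_def by (simp add: mult.commute)
  have "djet n (\<lambda>z. psi (snd z) * s)"
    by (rule jet_tempered_imp_djet, rule jet_mult[OF _ jet_psi jet_const]) simp
  from djet_add[OF djet_fst this] have t: "djet n (\<lambda>z. fst z + s * psi (snd z))"
    by (simp add: mult.commute)
  have tq: "djet n (\<lambda>z. circ_inv (fst z) + s * psi (snd z * speed (circ_inv (fst z))))"
    using djet_compose[OF c t q1 q2] by simp
  show "djet n (\<lambda>z. fst (conj_map s z))"
    using djet_compose[OF c djet_circ tq q2]
      by (simp add: conj_map_def stretch_def shear_def unstretch_def)
  have "djet n (\<lambda>z. snd z * inverse (speed (fst z)))"
    by (rule jet_tempered_imp_djet, rule jet_mult[OF _ jet_snd jet_inverse_speed]) simp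
  from djet_compose[OF c this tq q2] show "djet n (\<lambda>z. snd (conj_map s z))"
    by (simp add: conj_map_def stretch_def shear_def unstretch_def divide_inverse)
qed

text \<open>The shear is a horizontal shift by \<open>c * phi\<close> of the height, and that height
  is comparable to \<open>y\<close>. With \<open>f\<close> a component of
  \<open>conj_map (-1)\<close> this controls the deviation of \<open>twist_lift c\<close> from the
  identity.\<close>

lemma jet_rapid_conjugate_diff:
  assumes f: "\<And>n. djet n f"
  shows "jet rapid n (\<lambda>z. f (shear phi c (conj_map 1 z)) - f (conj_map 1 z))"
proof -
  have "jet rapid (Suc n) (\<lambda>z. phi (snd (fst (conj_map 1 z), snd (conj_map 1 z))))"
    by (rule jet_compose[OF _ comparable_conj_map jet_phi djet_conj_map]) simp
  from jet_mult[OF _ this jet_const[of _ c]]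
  have "jet rapid (Suc n) (\<lambda>z. c * phi (snd (conj_map 1 z)))" by (simp add: mult.commute)
  from jet_rapid_shift_diff[OF comparable_conj_map[of 1] f djet_conj_map(1)[of _ 1]
    djet_conj_map(2)[of _ 1] this]
  show ?thesis
    by (simp add: shear_def)
qed

text \<open>The identity is written as \<open>conj_map (-1)\<close> after \<open>conj_map 1\<close>,
  so that both components match \<open>jet_rapid_conjugate_diff\<close>.\<close>

lemma twist_lift_eq:
  "twist_lift c = (\<lambda>z. z + (ext0 (\<lambda>z. fst (conj_map (-1) (shear phi c (conj_map 1 z))) -
      fst (conj_map (-1) (conj_map 1 z))) z,
    ext0 (\<lambda>z. snd (conj_map (-1) (shear phi c (conj_map 1 z))) -
      snd (conj_map (-1) (conj_map 1 z))) z))"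
  by (auto simp: twist_lift_def ext0_def prod_eq_iff)

lemma Ck_on_twist_lift: "Ck_on k S (twist_lift c)"
  unfolding twist_lift_eq by (intro Ck_on_id_plus_ext0 jet_rapid_conjugate_diff djet_conj_map)

lemma has_derivative_twist_lift_boundary:
  assumes "snd z = 0"
  shows "(twist_lift c has_derivative (\<lambda>v. v)) (at z)"
proof -
  have *: "(ext0 (\<lambda>z. f (shear phi c (conj_map 1 z)) -
    f (conj_map 1 z)) has_derivative (\<lambda>v. 0)) (at z)"
    if f: "\<And>n. djet n f" for f
  proof -
    have "jet rapid (Suc 0) (\<lambda>z. f (shear phi c (conj_map 1 z)) - f (conj_map 1 z))"
      by (rule jet_rapid_conjugate_diff[OF f])
    then obtain p q where "rapid (\<lambda>z. f (shear phi c (conj_map 1 z)) - f (conj_map 1 z))"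
      "has_partials (\<lambda>z. f (shear phi c (conj_map 1 z)) - f (conj_map 1 z)) p q"
      by (rule jet_SucE)
    from has_derivative_ext0[OF this, of z] assms show ?thesis
      by (simp add: ext0_def[of p] ext0_def[of q])
  qed
  have "(twist_lift c has_derivative (\<lambda>v. v + (0, 0))) (at z)"
    unfolding twist_lift_eq
    by (rule has_derivative_add[OF has_derivative_ident has_derivative_Pair[OF *[OF
      djet_conj_map(1)] *[OF djet_conj_map(2)]]])
  then show ?thesis by (simp only: zero_prod_def[symmetric] add_0_right)
qed

section \<open>Preservation of area, with derivatives in the full plane\<close>

definition symplectic_at :: "(real \<times> real \<Rightarrow> real \<times> real) \<Rightarrow> real \<times> real \<Rightarrow> bool" where
  "symplectic_at M z \<longleftrightarrow>
     (\<exists>D. (M has_derivative D) (at z) \<and> (\<forall>u v. area_form (D u) (D v) = area_form u v))"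

lemma symplectic_at_compose:
  assumes "symplectic_at M z" "symplectic_at N (M z)"
  shows "symplectic_at (\<lambda>z. N (M z)) z"
proof -
  obtain D E where "(M has_derivative D) (at z)" "\<And>u v. area_form (D u) (D v) = area_form u v"
    "(N has_derivative E) (at (M z))" "\<And>u v. area_form (E u) (E v) = area_form u v"
    using assms unfolding symplectic_at_def by blast
  then show ?thesis
    unfolding symplectic_at_def
    by (intro exI[of _ "\<lambda>v. E (D v)"]) (auto intro: has_derivative_compose)
qed

text \<open>The Jacobian matrix is triangular with determinant \<open>a' * b\<close>; the derivative
  \<open>b'\<close> only enters off the diagonal.\<close>

lemma symplectic_at_fibred:
  assumes a: "(a has_real_derivative a') (at (fst z))"
    and b: "(b has_real_derivative b') (at (fst z))"
    and 1: "a' * b (fst z) = 1"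
  shows "symplectic_at (\<lambda>z. (a (fst z), snd z * b (fst z))) z"
proof -
  have f: "(fst has_derivative fst) (at z)" "(snd has_derivative snd) (at z)"
    by (auto intro!: derivative_eq_intros)
  have "((\<lambda>z. a (fst z)) has_derivative (\<lambda>v. a' * fst v)) (at z)"
    using has_derivative_compose[OF f(1) a[unfolded has_field_derivative_def]] .
  moreover have "((\<lambda>z. b (fst z)) has_derivative (\<lambda>v. b' * fst v)) (at z)"
    using has_derivative_compose[OF f(1) b[unfolded has_field_derivative_def]] .
  ultimately have "((\<lambda>z. (a (fst z), snd z * b (fst z))) has_derivative
      (\<lambda>v. (a' * fst v, snd z * (b' * fst v) + snd v * b (fst z)))) (at z)"
    by (intro has_derivative_Pair has_derivative_mult f)
  moreover have "area_form (a' * fst u, snd z * (b' * fst u) + snd u * b (fst z))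
      (a' * fst v, snd z * (b' * fst v) + snd v * b (fst z)) = area_form u v" for u v
  proof -
    have "area_form (a' * fst u, snd z * (b' * fst u) + snd u * b (fst z))
      (a' * fst v, snd z * (b' * fst v) + snd v * b (fst z)) = (a' * b (fst z)) * area_form u v"
      by (simp add: area_form_def algebra_simps)
    then show ?thesis using 1 by simp
  qed
  ultimately show ?thesis unfolding symplectic_at_def by blast
qed

lemma symplectic_at_stretch: "symplectic_at stretch z"
proof -
  have "((\<lambda>x. inverse (speed x)) has_real_derivative
      - (inverse (speed x) * - (pi * sin (2 * pi * x)) * inverse (speed x))) (at x)" for x
    using speed_pos[of x] by (intro DERIV_inverse' speed_has_derivative) simp
  from symplectic_at_fibred[OF circ_has_derivative this] speed_pos[of "fst z"]
  show ?thesis unfolding stretch_def divide_inverse by simp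
qed

lemma symplectic_at_unstretch: "symplectic_at unstretch z"
proof -
  have "((\<lambda>x. speed (circ_inv x)) has_real_derivative
      - (pi * sin (2 * pi * circ_inv x)) * inverse (speed (circ_inv x))) (at x)" for x
    by (rule DERIV_chain2[OF speed_has_derivative circ_inv_has_derivative])
  from symplectic_at_fibred[OF circ_inv_has_derivative this] speed_pos[of "circ_inv (fst z)"]
  show ?thesis unfolding unstretch_def by simp
qed

lemma symplectic_at_shear:
  assumes jet: "jet B (Suc 0) (\<lambda>z. h (snd z))" and z: "snd z > 0"
  shows "symplectic_at (shear h s) z"
proof -
  obtain p q where "has_partials (\<lambda>z. h (snd z)) p q" using jet by (rule jet_SucE)
  \<comment> \<open>As \<open>h (snd z)\<close> does not depend on \<open>x\<close>, the derivative
    of \<open>h\<close> can be read off on the vertical line \<open>x = 0\<close>.\<close>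
  then have 1: "((\<lambda>z. h (snd z)) has_derivative
      (\<lambda>v. p (0, snd z) * fst v + q (0, snd z) * snd v)) (at (0, snd z))"
    using has_partialsD z by force
  have "((\<lambda>t. (0, t)) has_derivative (\<lambda>v. (0, v))) (at (snd z))"
    by (auto intro!: derivative_eq_intros)
  from has_derivative_compose[OF this 1]
  have "(h has_derivative (\<lambda>v. q (0, snd z) * v)) (at (snd z))" by simp
  from has_derivative_compose[of snd snd z UNIV h, OF has_derivative_snd[OF has_derivative_ident]
    this]
  have h: "((\<lambda>z. h (snd z)) has_derivative (\<lambda>v. q (0, snd z) * snd v)) (at z)" .
  let ?D = "\<lambda>v. (fst v + s * (q (0, snd z) * snd v), snd v)"
  have "(shear h s has_derivative ?D) (at z)"
    unfolding shear_def by (auto intro!: derivative_eq_intros h)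
  moreover have "area_form (?D u) (?D v) = area_form u v" for u v
    by (simp add: area_form_def algebra_simps)
  ultimately show ?thesis unfolding symplectic_at_def by blast
qed

lemma snd_unstretch_pos: "snd z > 0 \<Longrightarrow> snd (unstretch z) > 0"
  using speed_pos by (simp add: unstretch_def)

lemma symplectic_at_conj_map: "snd z > 0 \<Longrightarrow> symplectic_at (conj_map s) z"
  unfolding conj_map_def
  by (rule symplectic_at_compose[OF symplectic_at_compose[OF symplectic_at_unstretch
          symplectic_at_shear[OF jet_psi snd_unstretch_pos]] symplectic_at_stretch])

lemma symplectic_at_twist_lift:
  assumes "snd z \<ge> 0"
  shows "symplectic_at (twist_lift c) z"
proof (cases "snd z > 0")
  case True
  have "snd (shear phi c (conj_map 1 z)) > 0" using snd_conj_map_pos[OF True]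
    by (simp add: shear_def)
  then have "symplectic_at (\<lambda>z. conj_map (-1) (shear phi c (conj_map 1 z))) z"
    by (rule symplectic_at_compose[OF symplectic_at_compose[OF symplectic_at_conj_map[OF True]
          symplectic_at_shear[OF jet_phi snd_conj_map_pos[OF True]]] symplectic_at_conj_map])
  then obtain D where D: "((\<lambda>z
    . conj_map (-1) (shear phi c (conj_map 1 z))) has_derivative D) (at z)"
    and a: "\<forall>u v. area_form (D u) (D v) = area_form u v"
    unfolding symplectic_at_def by blast
  have "open {z :: real \<times> real. snd z > 0}" by (intro open_Collect_less continuous_intros)
  then have "(twist_lift c has_derivative D) (at z)"
    by (rule has_derivative_transform_within_open[OF D]) (use True in \<open>auto simp: twist_lift_def\<close>)
  then show ?thesis using a unfolding symplectic_at_def by blast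
next
  case False
  then show ?thesis
    using has_derivative_twist_lift_boundary[of z c] assms unfolding symplectic_at_def by auto
qed

section \<open>Points moved horizontally to the left\<close>

text \<open>After \<open>unstretch\<close>, the line \<open>y = H\<close> becomes the graph of
  \<open>H * speed x\<close>. For small \<open>H\<close> the inverse shear moves \<open>x\<close> to
  \<open>x - 7 * ln (H * speed x)\<close>, which is \<open>backtrack x\<close> up to a
  constant.\<close>

definition backtrack :: "real \<Rightarrow> real" where "backtrack x = x - 7 * ln (speed x)"

lemma backtrack_has_derivative: "(backtrack has_real_derivative 1 +
  7 * (pi * sin (2 * pi * x)) / speed x) (at x)"
  unfolding backtrack_def using speed_pos[of x]
  by (auto intro!: derivative_eq_intros speed_has_derivative simp: field_simps)

text \<open>The interval is centred at 3/4, where the sine is -1, and its half-width 1/6 corresponds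
  to the angle \<open>pi / 3\<close>.\<close>

lemma sin_le_on_middle:
  assumes "7/12 \<le> x" "x \<le> 11/12"
  shows "sin (2 * pi * x) \<le> - 1/2"
proof -
  have "\<bar>x - 3/4\<bar> \<le> 1/6" using assms by (intro abs_leI) linarith+
  then have "2 * pi * \<bar>x - 3/4\<bar> \<le> 2 * pi * (1/6)" by (intro mult_left_mono) auto
  moreover have "\<bar>2 * pi * x - 3 * pi / 2\<bar> = 2 * pi * \<bar>x - 3/4\<bar>"
  proof -
    have "2 * pi * x - 3 * pi / 2 = 2 * pi * (x - 3/4)" by (simp add: algebra_simps)
    then show ?thesis by (simp only: abs_mult) simp
  qed
  ultimately have "\<bar>2 * pi * x - 3 * pi / 2\<bar> \<le> pi / 3" by simp
  then have "cos (pi / 3) \<le> cos \<bar>2 * pi * x - 3 * pi / 2\<bar>"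
    by (intro cos_monotone_0_pi_le) auto
  then have "1/2 \<le> cos (2 * pi * x - 3 * pi / 2)" by (simp add: cos_60)
  moreover have "cos (2 * pi * x - 3 * pi / 2) = - sin (2 * pi * x)"
  proof -
    have "3 * pi / 2 = pi + pi / 2" by simp
    then show ?thesis by (simp only: cos_diff cos_add sin_add) simp
  qed
  ultimately show ?thesis by simp
qed

text \<open>As \<open>pi > 3\<close>, the numerator is at most \<open>- 7 * (3/2)\<close>, hence at
  most \<open>- 7 * speed x\<close>; the slope is therefore at most 1 - 7.\<close>

lemma backtrack_slope:
  assumes "7/12 \<le> x" "x \<le> 11/12"
  shows "1 + 7 * (pi * sin (2 * pi * x)) / speed x \<le> -6"
proof -
  have "pi * sin (2 * pi * x) \<le> pi * (- 1/2)"
    using sin_le_on_middle[OF assms] by (intro mult_left_mono) auto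
  then have "7 * (pi * sin (2 * pi * x)) \<le> - 7 * speed x" using speed_le[of x] pi_gt3 by linarith
  then show ?thesis using speed_pos[of x] by (simp add: field_simps)
qed

lemma backtrack_decreasing:
  assumes "7/12 \<le> x" "x < y" "y \<le> 11/12"
  shows "backtrack y < backtrack x"
proof (rule DERIV_neg_imp_decreasing[OF assms(2)])
  fix t assume "x \<le> t" "t \<le> y"
  then have "1 + 7 * (pi * sin (2 * pi * t)) / speed t < 0"
    using backtrack_slope[of t] assms by simp
  then show "\<exists>D. (backtrack has_real_derivative D) (at t) \<and> D < 0"
    using backtrack_has_derivative by blast
qed

text \<open>Slope at most -6 over an interval of length 1/3.\<close>

lemma backtrack_drop: "backtrack (11/12) \<le> backtrack (7/12) - 2"
proof -
  have "\<exists>t>7/12. t < 11/12 \<and> backtrack (11/12) - backtrack (7/12) =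
      (11/12 - 7/12) * (1 + 7 * (pi * sin (2 * pi * t)) / speed t)"
    by (rule MVT2) (use backtrack_has_derivative in auto)
  then obtain t where "7/12 < t" "t < 11/12" "backtrack (11/12) - backtrack (7/12) =
      (11/12 - 7/12) * (1 + 7 * (pi * sin (2 * pi * t)) / speed t)" by blast
  then show ?thesis using backtrack_slope[of t] by simp
qed

lemma continuous_backtrack: "continuous_on S backtrack"
  by (rule DERIV_continuous_on, rule has_field_derivative_at_within, rule backtrack_has_derivative)

lemma continuous_speed: "continuous_on S speed"
  by (rule DERIV_continuous_on, rule has_field_derivative_at_within, rule speed_has_derivative)

lemma continuous_circ_inv: "continuous_on S circ_inv"
  using isCont_circ_inv continuous_at_imp_continuous_on by blast

text \<open>The height of the image of a level line under \<open>conj_map (-1)\<close>, in units of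
  the level; see \<open>conj_map_level\<close>.\<close>

definition height :: "real \<Rightarrow> real" where "height x = speed x / speed (backtrack x)"

lemma continuous_height: "continuous_on S height"
  unfolding height_def using speed_pos
  by (intro continuous_on_divide continuous_speed continuous_on_compose2[OF continuous_speed[of
    UNIV] continuous_backtrack])
    (auto simp: less_imp_neq[symmetric])

lemma speed_less_on_middle: "7/12 \<le> x \<Longrightarrow> x \<le> 11/12 \<Longrightarrow> speed x < 3/2"
proof (rule ccontr)
  assume x: "7/12 \<le> x" "x \<le> 11/12" "\<not> speed x < 3/2"
  then have "cos (2 * pi * x) \<ge> 1" unfolding speed_def by linarith
  then have "cos (2 * pi * x) = 1" by (intro antisym cos_le_one)
  then have "sin (2 * pi * x) = 0" by (simp add: cos_one_sin_zero)
  then show False using sin_le_on_middle[OF x(1,2)] by simp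
qed

text \<open>
  On \<open>[7/12, 11/12]\<close> the function \<open>backtrack\<close> descends by at least \<open>2\<close>, hence through a full period
  of \<open>speed\<close> from a maximum over a minimum to a maximum; the constant \<open>7\<close> is chosen for this.
\<close>

lemma height_local_max:
  obtains a b x0 where "a < x0" "x0 < b" "\<And>x. a \<le> x \<Longrightarrow> x \<le> b \<Longrightarrow> height x \<le> height x0"
    "\<And>x y. a \<le> x \<Longrightarrow> x < y \<Longrightarrow> y \<le> b \<Longrightarrow> backtrack y < backtrack x"
proof -
  define j where "j = \<lfloor>backtrack (7/12)\<rfloor>"
  have j: "real_of_int j \<le> backtrack (7/12)" "backtrack (7/12) < real_of_int j + 1"
    unfolding j_def by linarith+
  \<comment> \<open>The values from \<open>j - 1\<close> to \<open>j\<close> are attained: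
    \<open>j\<close> is the floor of the value at 7/12, and after a drop by 2 the function is below
    \<open>j - 1\<close>.\<close>
  have ivt: "\<exists>x. 7/12 \<le> x \<and> x \<le> 11/12 \<and> backtrack x = r"
    if "real_of_int j - 1 \<le> r" "r \<le> real_of_int j" for r
    using IVT2'[of backtrack "11/12" r "7/12", OF _ _ _ continuous_backtrack] that j
      backtrack_drop by auto
  obtain a where a: "7/12 \<le> a" "a \<le> 11/12" "backtrack a = real_of_int j"
    using ivt[of "real_of_int j"] by auto
  obtain b where b: "7/12 \<le> b" "b \<le> 11/12" "backtrack b = real_of_int j - 1"
    using ivt[of "real_of_int j - 1"] by auto
  obtain c where c: "7/12 \<le> c" "c \<le> 11/12" "backtrack c = real_of_int j - 1/2"
    using ivt[of "real_of_int j - 1/2"] by auto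
  have "a < c"
    using backtrack_decreasing[of c a] a c by (cases a c rule: linorder_cases) auto
  moreover have "c < b"
    using backtrack_decreasing[of b c] b c by (cases b c rule: linorder_cases) auto
  ultimately have abc: "a < c" "c < b" .
  have "speed (real_of_int j) = 3/2" "speed (real_of_int j - 1) = 3/2"
    using speed_periodic[of 0 j] speed_periodic[of 0 "j - 1"] by (simp_all add: speed_def[of 0])
  \<comment> \<open>At both ends the denominator of \<open>height\<close> has its maximum 3/2, which
    the numerator does not reach. At \<open>c\<close> the denominator has its minimum 1/2, so the
    maximum of \<open>height\<close> is interior.\<close>
  then have ends: "height a < 1" "height b < 1"
    using speed_less_on_middle[of a] speed_less_on_middle[of b] a b by (simp_all add: height_def)
  have "speed (real_of_int j - 1/2) = 1/2"
  proof -
    have "speed (- (1/2)) = 1/2" by (simp add: speed_def)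
    then show ?thesis using speed_periodic[of "- (1/2)" j] by simp
  qed
  then have mid: "height c \<ge> 1" using speed_ge[of c] c by (simp add: height_def)
  obtain x0 where x0: "x0 \<in> {a..b}" "\<And>x. x \<in> {a..b} \<Longrightarrow> height x \<le> height x0"
    using continuous_attains_sup[of "{a..b}" height, OF _ _ continuous_height] abc by force
  have "height x0 \<ge> 1" using x0(2)[of c] mid abc by simp
  then have "x0 \<noteq> a" "x0 \<noteq> b" using ends by auto
  then show ?thesis
    using that[of a x0 b] x0 backtrack_decreasing a b by auto
qed

lemma height_le: "height x \<le> 3" and height_pos: "height x > 0"
proof -
  have "speed x \<le> 3 * speed (backtrack x)"
    using speed_le[of x] speed_ge[of "backtrack x"] by linarith
  then show "height x \<le> 3" using speed_pos[of "backtrack x"] by (simp add: height_def field_simps)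
  show "height x > 0" using speed_pos by (simp add: height_def)
qed

text \<open>The logarithm turns the factor \<open>exp (-1/7) ^ n\<close> into the integer
  translation by \<open>n\<close>, which commutes with \<open>circ\<close> and does not affect
  \<open>speed\<close>. So all these curves have the same shape.\<close>

lemma conj_map_level:
  assumes "exp (-1/7) ^ n \<le> (1/12 :: real)"
  shows "conj_map (-1) (t, exp (-1/7) ^ n) =
    (circ (backtrack (circ_inv t)) + real n, exp (-1/7) ^ n * height (circ_inv t))"
proof -
  let ?H = "exp (-1/7 :: real) ^ n"
  \<comment> \<open>The product 1/12 * 3/2 is 1/8, the limit up to which \<open>psi\<close> is the
    pure logarithm.\<close>
  have "?H * speed (circ_inv t) \<le> 1/12 * (3/2)"
    using assms speed_le by (intro mult_mono) (auto simp: less_imp_le[OF speed_pos])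
  then have "psi (?H * speed (circ_inv t)) = 7 * ln (?H * speed (circ_inv t))"
    by (intro psi_small) simp
  also have "\<dots> = 7 * ln (speed (circ_inv t)) - real n"
    using speed_pos[of "circ_inv t"] by (simp add: ln_mult ln_realpow)
  finally have "circ_inv t + (-1) * psi (?H * speed (circ_inv t)) =
    backtrack (circ_inv t) + of_int (int n)"
    by (simp add: backtrack_def)
  then show ?thesis
    using circ_translate[of "backtrack (circ_inv t)"
      "int n"] speed_periodic[of "backtrack (circ_inv t)" "int n"]
    by (simp add: conj_map_def stretch_def unstretch_def shear_def height_def)
qed

text \<open>\<open>twist_lift 1\<close> moves the point of the curve with parameter \<open>t\<close>
  to the one with parameter \<open>t + phi H\<close>. At equal heights this is a horizontal
  displacement by \<open>-\<epsilon>\<close>, which the shift undoes.\<close>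

lemma twist_lift_level:
  assumes n: "exp (-1/7) ^ n \<le> (1/12 :: real)"
    and eq: "height (circ_inv (t + phi (exp (-1/7) ^ n))) = height (circ_inv t)"
    and e: "\<epsilon> = circ (backtrack (circ_inv t)) -
      circ (backtrack (circ_inv (t + phi (exp (-1/7) ^ n))))"
  shows "Fix (shifted (twist_lift 1) \<epsilon>) \<noteq> {}"
proof -
  let ?H = "exp (-1/7 :: real) ^ n"
  let ?z = "conj_map (-1) (t, ?H)"
  have "?H * height (circ_inv t) \<le> 1/12 * 3"
    using n height_le by (intro mult_mono) (auto simp: less_imp_le[OF height_pos])
  then have z: "0 < snd ?z" "?z \<in> strip"
    using height_pos[of "circ_inv t"] unfolding conj_map_level[OF n] strip_def by simp_all
  then have "twist_lift 1 ?z = conj_map (-1) (t + phi ?H, ?H)"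
    by (simp add: twist_lift_def shear_def)
  also have "\<dots> = ?z - (\<epsilon>, 0)" unfolding conj_map_level[OF n] using eq e by simp
  finally have "?z \<in> Fix (shifted (twist_lift 1) \<epsilon>)" using z by (simp add: Fix_def shifted_def)
  then show ?thesis by blast
qed

lemma phi_le: "y > 0 \<Longrightarrow> phi y \<le> y"
proof -
  assume y: "y > 0"
  have weight_y: "weight y \<ge> 1 / y" using y by (simp add: weight_def)
  have "weight y * phi y \<le> 1"
    using power_mult_exp_le[of "weight y" 1] weight_ge_1[OF y] by (simp add: phi_def)
  moreover have "1 / y * phi y \<le> weight y * phi y"
    using weight_y phi_pos[of y] by (intro mult_right_mono) auto
  ultimately have "1 / y * phi y \<le> 1" by linarith
  then show ?thesis using y by (simp add: field_simps)
qed

text \<open>A horizontal chord of parameter length \<open>d\<close> near the maximum. The increment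
  over \<open>[t, t + d]\<close> is nonnegative when the right end is the maximum and nonpositive
  when the left end is, so it vanishes in between.\<close>

lemma height_chord:
  assumes x0: "a < x0" "x0 < b" and max: "\<And>x. a \<le> x \<Longrightarrow> x \<le> b \<Longrightarrow> height x \<le> height x0"
    and d: "0 \<le> d" "d \<le> circ x0 - circ a" "d \<le> circ b - circ x0"
  obtains t where "circ x0 - d \<le> t" "t \<le> circ x0" "height (circ_inv (t + d)) = height (circ_inv t)"
proof -
  let ?h = "\<lambda>t. height (circ_inv (t + d)) - height (circ_inv t)"
  have le: "height (circ_inv t) \<le> height x0" if "circ a \<le> t" "t \<le> circ b" for t
    using that by (intro max; metis circ_circ_inv circ_less_iff not_le)
  have "\<exists>t\<ge>circ x0 - d. t \<le> circ x0 \<and> ?h t = 0"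
  proof (rule IVT2')
    show "?h (circ x0) \<le> 0" using le[of "circ x0 + d"] circ_less[OF x0(1)] d by simp
    show "0 \<le> ?h (circ x0 - d)" using le[of "circ x0 - d"] circ_less[OF x0(2)] d by simp
    show "continuous_on {circ x0 - d..circ x0} ?h"
      by (intro continuous_intros continuous_on_compose2[OF continuous_height[of UNIV]]
          continuous_on_compose2[OF continuous_circ_inv[of UNIV]]) auto
  qed (use d in auto)
  then show ?thesis using that by auto
qed

lemma shifted_twist_lift_fixed_points:
  obtains \<epsilon> :: "nat \<Rightarrow> real" where "\<And>n. \<epsilon> n > 0" "\<epsilon> \<longlonglongrightarrow> 0"
    "\<And>n. Fix (shifted (twist_lift 1) (\<epsilon> n)) \<noteq> {}"
proof -
  obtain a b x0 where x0: "a < x0" "x0 < b" and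
    max: "\<And>x. a \<le> x \<Longrightarrow> x \<le> b \<Longrightarrow> height x \<le> height x0" and
    dec: "\<And>x y. a \<le> x \<Longrightarrow> x < y \<Longrightarrow> y \<le> b \<Longrightarrow> backtrack y < backtrack x"
    by (rule height_local_max) (rule that)
  define H where "H = (\<lambda>n. exp (-1/7 :: real) ^ n)"
  have H0: "H \<longlonglongrightarrow> 0" unfolding H_def by (rule LIMSEQ_realpow_zero) auto
  \<comment> \<open>The bound 1/12 serves \<open>conj_map_level\<close>; the other two keep the
    chords inside the interval of the local maximum.\<close>
  define r where "r = min (1/12) (min (circ x0 - circ a) (circ b - circ x0))"
  have "r > 0" using circ_less x0 by (simp add: r_def)
  then obtain N where N: "\<And>n. n \<ge> N \<Longrightarrow> H n < r"
    using order_tendstoD(2)[OF H0] unfolding eventually_sequentially by blast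
  define d where "d = (\<lambda>n. phi (H (n + N)))"
  have Hpos: "H n > 0" for n by (simp add: H_def)
  have d: "0 < d n" "d n \<le> H (n + N)" "H (n + N) < r" for n
    using phi_pos phi_le[OF Hpos] N[of "n + N"] by (auto simp: d_def)
  have "\<exists>t. circ x0 - d n \<le> t \<and> t \<le> circ x0 \<and> height (circ_inv (t + d n)) =
    height (circ_inv t)" for n
  proof -
    have "0 \<le> d n" "d n \<le> circ x0 - circ a" "d n \<le> circ b - circ x0"
      using d[of n] by (auto simp: r_def)
    from height_chord[OF x0 max this] show ?thesis by blast
  qed
  then obtain t where t: "\<And>n. circ x0 - d n \<le> t n" "\<And>n. t n \<le> circ x0"
    "\<And>n. height (circ_inv (t n + d n)) = height (circ_inv (t n))" by metis
  define S where "S = (\<lambda>t. circ (backtrack (circ_inv t)))"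
  have "isCont S (circ x0)"
  proof -
    have "continuous_on UNIV S" unfolding S_def
      by (intro continuous_on_compose2[OF continuous_circ[of UNIV]]
          continuous_on_compose2[OF continuous_backtrack[of UNIV]] continuous_circ_inv) auto
    then show ?thesis by (simp add: continuous_on_eq_continuous_at)
  qed
  have d0: "d \<longlonglongrightarrow> 0"
    by (rule tendsto_sandwich[OF _ _ tendsto_const LIMSEQ_ignore_initial_segment[OF H0, of N]])
      (simp_all add: d less_imp_le)
  have t0: "t \<longlonglongrightarrow> circ x0"
    by (rule tendsto_sandwich[of "\<lambda>n. circ x0 - d n" _ _ "\<lambda>_. circ x0"])
      (use t tendsto_diff[OF tendsto_const d0, of "circ x0"] in auto)
  \<comment> \<open>Both ends of the chord converge to the maximum, so the displacements tend to 0.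
    They are positive because \<open>backtrack\<close> decreases there.\<close>
  define \<epsilon> where "\<epsilon> = (\<lambda>n. S (t n) - S (t n + d n))"
  have "\<epsilon> \<longlonglongrightarrow> S (circ x0) - S (circ x0)" unfolding \<epsilon>_def
    using tendsto_add[OF t0 d0]
    by (intro tendsto_diff isCont_tendsto_compose[OF \<open>isCont S (circ x0)\<close>] t0) simp
  then have "\<epsilon> \<longlonglongrightarrow> 0" by simp
  moreover have "\<epsilon> n > 0" for n
  proof -
    have "d n \<le> circ x0 - circ a" "d n \<le> circ b - circ x0" using d[of n] by (auto simp: r_def)
    then have "circ a \<le> t n" "t n + d n \<le> circ b" using t[of n] by auto
    then have "a \<le> circ_inv (t n)" "circ_inv (t n + d n) \<le> b"
      by (metis circ_circ_inv circ_less_iff not_le)+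
    moreover have "circ_inv (t n) < circ_inv (t n + d n)" using d(1)[of n]
      by (simp add: circ_inv_less_iff)
    ultimately show ?thesis using dec unfolding \<epsilon>_def S_def by (simp add: circ_less_iff)
  qed
  moreover have "Fix (shifted (twist_lift 1) (\<epsilon> n)) \<noteq> {}" for n
  proof (rule twist_lift_level[of "n + N" "t n"])
    show "exp (-1/7) ^ (n + N) \<le> (1/12 :: real)" using d[of n] by (simp add: r_def H_def)
    show "height (circ_inv (t n + phi (exp (-1/7) ^ (n + N)))) = height (circ_inv (t n))"
      using t(3)[of n] by (simp add: d_def H_def)
  qed (simp add: \<epsilon>_def S_def d_def H_def)
  ultimately show ?thesis using that by blast
qed

section \<open>Descent to the annulus\<close>

lemma circle_of_eq_iff: "circle_of x = circle_of y \<longleftrightarrow> x - y \<in> \<int>"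
  by (rule circle.abs_eq_iff)

lemma circle_of_rep [simp]: "circle_of (circle_rep c) = c"
  by (rule Quotient3_abs_rep[OF Quotient3_circle])

lemma cover_eqE:
  assumes "cover z = cover z'"
  obtains n where "z = z' + (of_int n, 0)"
proof -
  have "fst z - fst z' \<in> \<int>" "snd z = snd z'"
    using assms by (auto simp: cover_def circle_of_eq_iff)
  then obtain n where "fst z = fst z' + of_int n" by (metis Ints_cases add.commute diff_add_cancel)
  then show ?thesis using that \<open>snd z = snd z'\<close> by (simp add: prod_eq_iff)
qed

lemma cover_translate [simp]: "cover (z + (of_int n, 0)) = cover z"
  by (simp add: cover_def circle_of_eq_iff)

text \<open>A section of \<open>cover\<close> without any continuity. What is defined through it
  does not depend on the choice if the map upstairs commutes with integer translations.\<close>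

definition lift_point :: "circle \<times> real \<Rightarrow> real \<times> real" where
  "lift_point p = (circle_rep (fst p), snd p)"

lemma cover_lift_point [simp]: "cover (lift_point p) = p"
  by (simp add: cover_def lift_point_def)

lemma lift_point_coverE:
  obtains n where "lift_point (cover z) = z + (of_int n, 0)"
  using cover_eqE[of "lift_point (cover z)" z] by auto

lemma cover_in_annulus_iff [simp]: "cover z \<in> annulus \<longleftrightarrow> z \<in> strip"
  by (cases z) (simp add: cover_def annulus_def strip_def)

section \<open>The covering map as an open quotient map\<close>

lemma continuous_circle_of: "continuous_on S circle_of"
  by (rule continuous_on_subset[of UNIV]) (auto simp: continuous_on_open_vimage open_circle_def)

text \<open>The full preimage of the image of \<open>B\<close> is the union of the integer
  translates of \<open>B\<close>.\<close>

lemma open_circle_of_image: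
  assumes "open B"
  shows "open (circle_of ` B)"
proof -
  have "circle_of -` circle_of ` B = (\<Union>n. (\<lambda>x. of_int n + x) ` B)"
  proof (intro set_eqI iffI)
    fix x assume "x \<in> circle_of -` circle_of ` B"
    then obtain y where "y \<in> B" "x - y \<in> \<int>" by (auto simp: circle_of_eq_iff)
    then show "x \<in> (\<Union>n. (\<lambda>x. of_int n + x) ` B)"
      by (metis Ints_cases UN_I UNIV_I diff_add_cancel image_eqI)
  next
    fix x assume "x \<in> (\<Union>n. (\<lambda>x. of_int n + x) ` B)"
    then obtain n y where "y \<in> B" "x = of_int n + y" by auto
    moreover then have "circle_of x = circle_of y" by (simp add: circle_of_eq_iff)
    ultimately show "x \<in> circle_of -` circle_of ` B" by simp
  qed
  then show ?thesis
    unfolding open_circle_def using assms by (auto intro!: open_UN open_translation)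
qed

lemma continuous_cover: "continuous_on S cover"
  unfolding cover_def
  by (intro continuous_on_Pair continuous_on_compose2[OF continuous_circle_of[of UNIV]]
      continuous_intros) auto

text \<open>The additional first factor is for the parameter of a homotopy.\<close>

lemma open_cover_image:
  assumes "open W"
  shows "open ((\<lambda>p. (fst p, cover (snd p))) ` W)"
proof (rule topological_space_class.openI)
  fix q :: "'a \<times> circle \<times> real"
  assume "q \<in> (\<lambda>p. (fst p, cover (snd p))) ` W"
  then obtain t x y where p: "(t, x, y) \<in> W" "q = (t, cover (x, y))" by auto
  obtain A V where A: "open A" "open V" "t \<in> A" "(x, y) \<in> V" "A \<times> V \<subseteq> W"
    using open_prod_elim[OF assms p(1)] by (metis mem_Times_iff fst_conv snd_conv)
  obtain B C where B: "open B" "open C" "x \<in> B" "y \<in> C" "B \<times> C \<subseteq> V"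
    using open_prod_elim[OF A(2,4)] by (metis mem_Times_iff fst_conv snd_conv)
  have "A \<times> circle_of ` B \<times> C \<subseteq> (\<lambda>p. (fst p, cover (snd p))) ` W"
  proof
    fix r assume "r \<in> A \<times> circle_of ` B \<times> C"
    then obtain a b c where "r = (a, circle_of b, c)" "a \<in> A" "b \<in> B" "c \<in> C" by auto
    then have "r = (\<lambda>p. (fst p, cover (snd p))) (a, b, c)" "(a, b, c) \<in> W"
      using A B by (auto simp: cover_def)
    then show "r \<in> (\<lambda>p. (fst p, cover (snd p))) ` W" by (rule image_eqI)
  qed
  moreover have "open (A \<times> circle_of ` B \<times> C)"
    by (intro open_Times A B open_circle_of_image)
  moreover have "q \<in> A \<times> circle_of ` B \<times> C" using A B p by (auto simp: cover_def)
  ultimately show "\<exists>T. open T \<and> q \<in> T \<and> T \<subseteq> (\<lambda>p. (fst p, cover (snd p))) ` W" by blast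
qed

text \<open>The universal property of the quotient, relative to \<open>I \<times> strip\<close>,
  which is the full preimage of \<open>I \<times> annulus\<close>. Open sets upstairs are pushed
  down by \<open>open_cover_image\<close>.\<close>

lemma continuous_on_annulus_descend:
  assumes "continuous_on (I \<times> strip) (\<lambda>p. h (fst p, cover (snd p)))"
  shows "continuous_on (I \<times> annulus) h"
  unfolding continuous_on_open_invariant
proof (intro allI impI)
  fix T :: "'b set" assume "open T"
  let ?q = "\<lambda>p. (fst p, cover (snd p))"
  obtain W where W: "open W" "W \<inter> I \<times> strip = (\<lambda>p. h (?q p)) -` T \<inter> I \<times> strip"
    using assms \<open>open T\<close> unfolding continuous_on_open_invariant by blast
  have q: "?q p \<in> I \<times> annulus \<longleftrightarrow> p \<in> I \<times> strip" for p :: "'a \<times> real \<times> real"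
    by (simp add: mem_Times_iff)
  have "?q ` W \<inter> I \<times> annulus = h -` T \<inter> I \<times> annulus"
  proof (intro set_eqI iffI)
    fix r assume r: "r \<in> ?q ` W \<inter> I \<times> annulus"
    then obtain p where p: "p \<in> W" "r = ?q p" by auto
    then have "p \<in> W \<inter> I \<times> strip" using r q by blast
    then show "r \<in> h -` T \<inter> I \<times> annulus" using W p r by auto
  next
    fix r assume r: "r \<in> h -` T \<inter> I \<times> annulus"
    define p where "p = (fst r, lift_point (snd r))"
    have p: "r = ?q p" by (simp add: p_def)
    then have "p \<in> (\<lambda>p. h (?q p)) -` T \<inter> I \<times> strip" using r q by blast
    then have "p \<in> W" using W by blast
    then show "r \<in> ?q ` W \<inter> I \<times> annulus" using p r by blast
  qed
  then show "\<exists>A. open A \<and> A \<inter> I \<times> annulus = h -` T \<inter> I \<times> annulus"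
    using open_cover_image[OF W(1)] by blast
qed

definition twist :: "real \<Rightarrow> circle \<times> real \<Rightarrow> circle \<times> real" where
  "twist c p = cover (twist_lift c (lift_point p))"

section \<open>The twist as a diffeomorphism of the annulus\<close>

lemma snd_shear [simp]: "snd (shear h s z) = snd z"
  by (simp add: shear_def)

lemma twist_lift_translate: "twist_lift c (z + (of_int n, 0)) = twist_lift c z + (of_int n, 0)"
proof -
  have G: "conj_map s (z + (of_int n, 0)) = conj_map s z + (of_int n, 0)" for s z
    using conj_map_translate[of s "fst z" n "snd z"] by (simp add: plus_prod_def)
  have "shear phi c (z + (of_int n, 0)) = shear phi c z + (of_int n, 0)" for z
    by (simp add: shear_def)
  then show ?thesis by (simp add: twist_lift_def G)
qed

lemma twist_cover: "twist c (cover z) = cover (twist_lift c z)"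
  by (metis twist_lift_translate cover_translate twist_def lift_point_coverE)

lemma twist_lift_inverse [simp]: "twist_lift c (twist_lift (-c) z) = z"
  by (simp add: twist_lift_def snd_conj_map_pos shear_shear)

lemma twist_inverse: "twist c (twist (-c) p) = p"
  by (metis twist_lift_inverse cover_lift_point twist_cover)

text \<open>A point sent to height at least 1 would be sent back by the inverse map, which fixes
  everything there; hence it would equal its image.\<close>

lemma snd_conj_map_less_1:
  assumes "snd z < 1" "s = 1 \<or> s = -1"
  shows "snd (conj_map s z) < 1"
proof (rule ccontr)
  assume "\<not> snd (conj_map s z) < 1"
  then have "conj_map (-s) (conj_map s z) = conj_map s z" by (intro conj_map_large) simp
  then have "conj_map s z = z" using assms(2) by (auto simp: conj_map_inverse)
  then show False using assms \<open>\<not> snd (conj_map s z) < 1\<close> by simp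
qed

lemma twist_lift_large: "snd z \<ge> 1 \<Longrightarrow> twist_lift c z = shear phi c z"
  by (simp add: twist_lift_def conj_map_large)

lemma twist_lift_strip:
  assumes "z \<in> strip"
  shows "twist_lift c z \<in> strip"
proof -
  have z: "0 \<le> snd z" "snd z \<le> 1" using assms by (auto simp: strip_def)
  have "snd (twist_lift c z) \<ge> 0"
    using z by (auto simp: twist_lift_def intro!: less_imp_le snd_conj_map_pos)
  moreover have "snd (twist_lift c z) \<le> 1"
  proof (cases "snd z < 1")
    case True
    then have "snd (conj_map 1 z) < 1" by (rule snd_conj_map_less_1) simp
    then have "snd (conj_map (-1) (shear phi c (conj_map 1 z))) < 1"
      by (intro snd_conj_map_less_1) simp_all
    then show ?thesis using z by (simp add: twist_lift_def)
  next
    case False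
    then show ?thesis using z by (simp add: twist_lift_large)
  qed
  ultimately show ?thesis by (simp add: strip_def mem_Times_iff)
qed

lemma continuous_twist_lift: "continuous_on S (twist_lift c)"
  using Ck_on_twist_lift[of 0 S c] unfolding Ck_on_def
    by (metis Cn_on.simps(1) order_refl zero_enat_def)

text \<open>The hypothesis is restricted to the strip so that it also covers
  \<open>inv_into annulus (twist c)\<close>, which is known to equal \<open>twist (-c)\<close> only
  on the annulus.\<close>

lemma local_lift_twist_lift:
  assumes "\<And>z. z \<in> strip \<Longrightarrow> f (cover z) = cover (twist_lift c z)"
  shows "local_lift f UNIV (twist_lift c)"
  using assms continuous_twist_lift twist_lift_strip by (auto simp: local_lift_def)

lemma annulus_Ck_twist_lift:
  assumes "\<And>z. z \<in> strip \<Longrightarrow> f (cover z) = cover (twist_lift c z)"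
  shows "annulus_Ck k f"
  unfolding annulus_Ck_def using local_lift_twist_lift[OF assms] Ck_on_twist_lift by blast

lemma twist_annulus: "p \<in> annulus \<Longrightarrow> twist c p \<in> annulus"
  by (metis twist_lift_strip cover_in_annulus_iff cover_lift_point twist_cover)

lemma twist_inverse': "twist (-c) (twist c p) = p"
  using twist_inverse[of "-c"] by simp

lemma bij_betw_twist: "bij_betw (twist c) annulus annulus"
  by (rule bij_betwI[of _ _ _ "twist (-c)"]) (
    rule Pi_I, erule twist_annulus, rule Pi_I, erule twist_annulus, rule twist_inverse', rule
      twist_inverse)

lemma inv_into_twist: "p \<in> annulus \<Longrightarrow> inv_into annulus (twist c) p = twist (-c) p"
  by (rule inv_into_f_eq[OF bij_betw_imp_inj_on[OF bij_betw_twist] twist_annulus twist_inverse])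

lemma preserves_area_twist: "preserves_area (twist c)"
  unfolding preserves_area_def
proof
  fix z assume "z \<in> strip"
  then have "symplectic_at (twist_lift c) z"
    by (intro symplectic_at_twist_lift) (auto simp: strip_def)
  then obtain D where "(twist_lift c has_derivative D) (at z)"
    "\<forall>u v. area_form (D u) (D v) = area_form u v"
    unfolding symplectic_at_def by blast
  then show "\<exists>U F D. z \<in> U \<and> local_lift (twist c) U F \<and>
      (F has_derivative D) (at z within strip \<inter> U) \<and> (\<forall>u v. area_form (D u) (D v) = area_form u v)"
    by (intro exI[of _ UNIV] exI[of _ "twist_lift c"] exI[of _ D])
      (simp add: local_lift_twist_lift[OF twist_cover] has_derivative_at_withinI)
qed

text \<open>The straight-line homotopy from the lift to the identity stays in the convex strip and
  commutes with integer translations, so it descends.\<close>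

lemma homotopic_twist_id: "homotopic_with_canon (\<lambda>_. True) annulus annulus (twist c) id"
proof -
  define L where "L = (\<lambda>t z. (1 - t) *\<^sub>R twist_lift c z + t *\<^sub>R z)"
  define h where "h = (\<lambda>p. cover (L (fst p) (lift_point (snd p))))"
  have L: "L t (z + (of_int n, 0)) = L t z + (of_int n, 0)" for t n z
    by (simp add: L_def twist_lift_translate algebra_simps flip: scaleR_add_left)
  have hc: "h (t, cover z) = cover (L t z)" for t z
    unfolding h_def by (metis L cover_translate fst_conv lift_point_coverE snd_conv)
  have "convex strip" unfolding strip_def by (intro convex_Times) auto
  then have strip: "L t z \<in> strip" if "t \<in> {0..1}" "z \<in> strip" for t z
    unfolding L_def using that twist_lift_strip by (intro convexD) auto
  have "continuous_on ({0..1} \<times> strip) (\<lambda>p. cover (L (fst p) (snd p)))"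
    unfolding L_def
    by (intro continuous_on_compose2[OF continuous_cover[of UNIV]] continuous_intros
        continuous_on_compose2[OF continuous_twist_lift[of UNIV]]) auto
  then have "continuous_on ({0..1} \<times> annulus) h"
    by (intro continuous_on_annulus_descend) (simp add: hc)
  moreover have "h (t, p) \<in> annulus" if "t \<in> {0..1}" "p \<in> annulus" for t p
    using strip[of t "lift_point p"] that hc[of t "lift_point p"] cover_in_annulus_iff[of
      "lift_point p"] by simp
  moreover have "h (0, p) = twist c p" "h (1, p) = id p" for p
    by (simp_all add: h_def L_def twist_def)
  ultimately show ?thesis
    unfolding homotopic_with_def prod_topology_subtopology_eu
    by (intro exI[of _ h]) auto
qed

lemma twist_Diff: "twist c \<in> Diff k"
proof -
  have "annulus_Ck k (inv_into annulus (twist c))"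
  proof (rule annulus_Ck_twist_lift)
    fix z assume "z \<in> strip"
    then show "inv_into annulus (twist c) (cover z) = cover (twist_lift (-c) z)"
      by (simp add: inv_into_twist twist_cover)
  qed
  then show ?thesis
    using annulus_Ck_twist_lift[OF twist_cover] bij_betw_twist preserves_area_twist
      homotopic_twist_id
    by (auto simp: Diff_def)
qed

lemma twist_lift_boundary: "twist_lift c (x, 0) = (x, 0)"
  by (simp add: twist_lift_def)

text \<open>A fixed point above the lower boundary would be carried by \<open>conj_map 1\<close> to
  a fixed point of the shear, contradicting \<open>phi > 0\<close>.\<close>

lemma Fix_twist_lift: "Fix (twist_lift 1) = UNIV \<times> {0}"
proof -
  have "twist_lift 1 z \<noteq> z" if "snd z > 0" for z
  proof
    assume "twist_lift 1 z = z"
    then have "conj_map 1 (conj_map (-1) (shear phi 1 (conj_map 1 z))) = conj_map 1 z" using that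
      by (simp only: twist_lift_def if_True)
    then have "shear phi 1 (conj_map 1 z) = conj_map 1 z" by (simp only: conj_map_inverse)
    then show False using phi_pos[of "snd (conj_map 1 z)"] by (simp add: shear_def prod_eq_iff)
  qed
  then have "twist_lift 1 z = z \<longleftrightarrow> snd z \<le> 0" for z
    by (auto simp: twist_lift_def)
  then show ?thesis by (auto simp: Fix_def strip_def)
qed

lemma is_lift_twist_lift: "is_lift (twist c) (twist_lift c)"
  unfolding is_lift_def by (rule local_lift_twist_lift[OF twist_cover])

lemma twist_Diff0: "twist 1 \<in> Diff0 k"
proof -
  have "twist 1 (c, 0) = (c, 0)" for c
    using twist_cover[of 1 "(circle_rep c, 0)"] by (simp add: twist_lift_boundary cover_def)
  \<comment> \<open>At height 1 the conjugation is trivial, so the map is the shear by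
    \<open>phi 1\<close>.\<close>
  moreover have "fst (twist_lift 1 (x, 1)) > x" for x
    using phi_pos[of 1] by (simp add: twist_lift_large shear_def)
  ultimately show ?thesis
    using twist_Diff is_lift_twist_lift twist_lift_boundary Fix_twist_lift
      unfolding Diff0_def by blast
qed

theorem theorem1p5:
  shows "\<exists>f \<in> Diff0 \<infinity>. \<exists>\<epsilon> :: nat \<Rightarrow> real.
           (\<forall>n. \<epsilon> n > 0) \<and> \<epsilon> \<longlonglongrightarrow> 0 \<and>
           (\<exists>F \<in> Diff0_lifts \<infinity>. is_lift f F \<and> (\<forall>x. F (x, 0) = (x, 0)) \<and>
              (\<forall>n. Fix (shifted F (\<epsilon> n)) \<noteq> {}))"
proof -
  obtain \<epsilon> :: "nat \<Rightarrow> real" where "\<And>n. \<epsilon> n > 0" "\<epsilon> \<longlonglongrightarrow> 0"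
    "\<And>n. Fix (shifted (twist_lift 1) (\<epsilon> n)) \<noteq> {}"
    by (rule shifted_twist_lift_fixed_points) (rule that)
  moreover have "twist_lift 1 \<in> Diff0_lifts \<infinity>"
    unfolding Diff0_lifts_def using twist_Diff0 is_lift_twist_lift twist_lift_boundary by blast
  ultimately show ?thesis
    using twist_Diff0 is_lift_twist_lift twist_lift_boundary by blast
qed

end
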